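(* Let $n=p+q$ with $p\ge q$. For any $n\times n$ complex orthogonal matrix $O$, there exist an $n\times n$ real orthogonal matrix $U$, two complex orthogonal matrices $V_p\in\mathrm{O}(p,\mathbb{C})$ and $V_q\in\mathrm{O}(q,\mathbb{C})$, and $q$ unique (up to order and signs) real numbers $\theta_1,\dots,\theta_q$ such that $$O=U\begin{bmatrix}Ch&0&iSh\\0&I_{p-q}&0\\-iSh&0&Ch\end{bmatrix}\begin{bmatrix}V_p&0\\0&V_q\end{bmatrix}.$$
   Context: $\mathrm{O}(n,\mathbb{C})=\{G\in\mathbb{C}^{n\times n}:G^TG=I_n\}$ with $^T$ the ordinary (non-conjugate) transpose; its elements are called complex orthogonal matrices. $Ch=\operatorname{diag}(\cosh\theta_1,\dots,\cosh\theta_q)$ and $Sh=\operatorname{diag}(\sinh\theta_1,\dots,\sinh\theta_q)$; the block sizes of the middle factor are $q,\,p-q,\,q$. *)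

theory Defs
  imports
    Complex_Main
    "HOL-Combinatorics.Permutations"
    "Jordan_Normal_Form.Matrix"
begin

text \<open>The transpose is the plain, non-conjugating one also over the complex numbers. The library
  predicate \<open>orthogonal_mat\<close> is not used: it does not require the columns
  to be normalized.\<close>

definition orthogonal_group :: "nat \<Rightarrow> 'a :: comm_ring_1 mat set" where
  "orthogonal_group n = {G \<in> carrier_mat n n. transpose_mat G * G = 1\<^sub>m n}"

text \<open>The zero matrices with no columns, respectively no rows, serve to stack \<open>A13\<close> on top of
  \<open>A23\<close> and to put \<open>A31\<close> next to \<open>A32\<close>.\<close>

definition nine_block_mat ::
  "'a :: zero mat \<Rightarrow> 'a mat \<Rightarrow> 'a mat \<Rightarrow>
   'a mat \<Rightarrow> 'a mat \<Rightarrow> 'a mat \<Rightarrow>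
   'a mat \<Rightarrow> 'a mat \<Rightarrow> 'a mat \<Rightarrow> 'a mat" where
  "nine_block_mat A11 A12 A13 A21 A22 A23 A31 A32 A33 =
     four_block_mat
       (four_block_mat A11 A12 A21 A22)
       (four_block_mat A13 (0\<^sub>m (dim_row A13) 0) A23 (0\<^sub>m (dim_row A23) 0))
       (four_block_mat A31 A32 (0\<^sub>m 0 (dim_col A31)) (0\<^sub>m 0 (dim_col A32)))
       A33"

definition Ch_mat :: "real vec \<Rightarrow> complex mat" where
  "Ch_mat \<theta> = mat_diag (dim_vec \<theta>) (\<lambda>k. complex_of_real (cosh (\<theta> $ k)))"

definition Sh_mat :: "real vec \<Rightarrow> complex mat" where
  "Sh_mat \<theta> = mat_diag (dim_vec \<theta>) (\<lambda>k. complex_of_real (sinh (\<theta> $ k)))"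

definition middle_factor :: "nat \<Rightarrow> nat \<Rightarrow> real vec \<Rightarrow> complex mat" where
  "middle_factor p q \<theta> = nine_block_mat
     (Ch_mat \<theta>)              (0\<^sub>m q (p - q))       (\<i> \<cdot>\<^sub>m Sh_mat \<theta>)
     (0\<^sub>m (p - q) q)        (1\<^sub>m (p - q))         (0\<^sub>m (p - q) q)
     ((- \<i>) \<cdot>\<^sub>m Sh_mat \<theta>)   (0\<^sub>m q (p - q))       (Ch_mat \<theta>)"

definition is_factorization ::
  "nat \<Rightarrow> nat \<Rightarrow> complex mat \<Rightarrow> real mat \<Rightarrow> complex mat \<Rightarrow> complex mat \<Rightarrow> real vec \<Rightarrow> bool" where
  "is_factorization p q Q U V\<^sub>p V\<^sub>q \<theta> \<longleftrightarrow>
     U \<in> orthogonal_group (p + q) \<and> V\<^sub>p \<in> orthogonal_group p \<and> V\<^sub>q \<in> orthogonal_group q \<and>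
     \<theta> \<in> carrier_vec q \<and>
     Q = map_mat complex_of_real U * middle_factor p q \<theta> *
         four_block_mat V\<^sub>p (0\<^sub>m p q) (0\<^sub>m q p) V\<^sub>q"

definition eq_up_to_order_and_signs :: "nat \<Rightarrow> real vec \<Rightarrow> real vec \<Rightarrow> bool" where
  "eq_up_to_order_and_signs q \<theta> \<theta>' \<longleftrightarrow>
     (\<exists>\<pi>. \<pi> permutes {..<q} \<and> (\<forall>k<q. \<theta>' $ k = \<theta> $ \<pi> k \<or> \<theta>' $ k = - \<theta> $ \<pi> k))"

end

theory Submission
  imports
    Defs
    "Jordan_Normal_Form.Char_Poly"
begin

text \<open>Let \<open>J = diag(I\<^sub>p, -I\<^sub>q)\<close> and \<open>S = Q J Q\<^sup>T = A + \<i> B\<close>. As \<open>S\<close> is a complex symmetric involution,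
  \<open>A\<close> and \<open>B\<close> are real symmetric with \<open>A\<^sup>2 = I + B\<^sup>2\<close> and \<open>A B = - B A\<close>. Hence the eigenvalues of
  \<open>A\<close> have modulus at least one, and \<open>B\<close> exchanges the eigenspaces of \<open>a\<close> and \<open>-a\<close>, injectively
  for \<open>a > 1\<close>, while it vanishes on those of \<open>1\<close> and \<open>-1\<close>. Together with \<open>tr A = p - q\<close> this gives a
  real orthonormal basis, the columns of \<open>U\<close>, in which \<open>S\<close> becomes \<open>M(\<theta>) J M(\<theta>)\<^sup>T = M(2\<theta>) J\<close>, where
  \<open>M\<close> is the middle factor. Then \<open>M(\<theta>)\<^sup>T U\<^sup>T Q\<close> is orthogonal and commutes with \<open>J\<close>, so it is block
  diagonal. Conversely, every factorization of \<open>Q\<close> diagonalizes \<open>A\<close>, with eigenvalues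
  \<open>cosh(2\<theta>\<^sub>k)\<close>, \<open>1\<close> (\<open>p - q\<close> times) and \<open>-cosh(2\<theta>\<^sub>k)\<close>, which determines the \<open>\<theta>\<^sub>k\<close> up to order and
  signs.\<close>

section \<open>Diagonalization of real symmetric matrices\<close>

lemma symmetric_mat_scalar_prod:
  fixes A :: "'a :: comm_semiring_0 mat"
  assumes "A \<in> carrier_mat n n" "A\<^sup>T = A" "x \<in> carrier_vec n" "y \<in> carrier_vec n"
  shows "(A *\<^sub>v x) \<bullet> y = x \<bullet> (A *\<^sub>v y)"
  using transpose_vec_mult_scalar[OF assms(1,4,3)] assms(2) by simp

lemma Re_mult_mat_vec:
  assumes "A \<in> carrier_mat m n" "v \<in> carrier_vec n"
  shows "map_vec Re (map_mat complex_of_real A *\<^sub>v v) = A *\<^sub>v map_vec Re v"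
  using assms by (intro eq_vecI) (auto simp: scalar_prod_def)

lemma Im_mult_mat_vec:
  assumes "A \<in> carrier_mat m n" "v \<in> carrier_vec n"
  shows "map_vec Im (map_mat complex_of_real A *\<^sub>v v) = A *\<^sub>v map_vec Im v"
  using assms by (intro eq_vecI) (auto simp: scalar_prod_def)

lemma real_scalar_prod_self_nonneg: "0 \<le> (v :: real vec) \<bullet> v"
  by (auto simp: scalar_prod_def intro: sum_nonneg)

lemma real_scalar_prod_self_eq_0:
  assumes "(v :: real vec) \<in> carrier_vec n"
  shows "v \<bullet> v = 0 \<longleftrightarrow> v = 0\<^sub>v n"
  using conjugate_square_eq_0_vec[OF assms] by simp

lemma real_normalize:
  assumes "(v :: real vec) \<in> carrier_vec n" "v \<noteq> 0\<^sub>v n"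
  shows "((1 / sqrt (v \<bullet> v)) \<cdot>\<^sub>v v) \<bullet> ((1 / sqrt (v \<bullet> v)) \<cdot>\<^sub>v v) = 1"
proof -
  have "v \<bullet> v > 0"
    using real_scalar_prod_self_nonneg[of v] real_scalar_prod_self_eq_0[OF assms(1)] assms(2)
    by (simp add: less_le)
  then show ?thesis using assms(1) by (simp add: field_simps)
qed

text \<open>Take a complex root \<open>e\<close> of the characteristic polynomial with eigenvector x
  + i y. Symmetry of \<open>A\<close>, tested on x against y, forces \<open>e\<close> to be real;
  then x or y, whichever is nonzero, is a real eigenvector.\<close>

lemma real_symmetric_eigenvector:
  fixes A :: "real mat"
  assumes A: "A \<in> carrier_mat n n" and sym: "A\<^sup>T = A" and "n > 0"
  obtains a v where "v \<in> carrier_vec n" "v \<bullet> v = 1" "A *\<^sub>v v = a \<cdot>\<^sub>v v"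
proof -
  let ?A = "map_mat complex_of_real A"
  have cA: "?A \<in> carrier_mat n n" using A by simp
  obtain as where as: "char_poly ?A = (\<Prod>a\<leftarrow>as. [:- a, 1:])" "length as = n"
    using char_poly_factorized[OF cA] by blast
  with \<open>n > 0\<close> obtain e where "e \<in> set as" by (cases as) auto
  then have "poly (char_poly ?A) e = 0"
    by (auto simp: as poly_prod_list prod_list_zero_iff)
  then obtain v where v: "v \<in> carrier_vec n" "v \<noteq> 0\<^sub>v n" "?A *\<^sub>v v = e \<cdot>\<^sub>v v"
    using eigenvalue_root_char_poly[OF cA, of e] cA
    by (auto simp: eigenvalue_def eigenvector_def)
  define x y where "x = map_vec Re v" and "y = map_vec Im v"
  have xy: "x \<in> carrier_vec n" "y \<in> carrier_vec n" using v by (auto simp: x_def y_def)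
  have Ax: "A *\<^sub>v x = Re e \<cdot>\<^sub>v x - Im e \<cdot>\<^sub>v y"
    unfolding x_def Re_mult_mat_vec[OF A v(1), symmetric] v(3) y_def
    using v by (intro eq_vecI) auto
  have Ay: "A *\<^sub>v y = Im e \<cdot>\<^sub>v x + Re e \<cdot>\<^sub>v y"
    unfolding y_def Im_mult_mat_vec[OF A v(1), symmetric] v(3) x_def
    using v by (intro eq_vecI) auto
  have "(A *\<^sub>v x) \<bullet> y = x \<bullet> (A *\<^sub>v y)" by (rule symmetric_mat_scalar_prod[OF A sym xy])
  \<comment> \<open>Both sides contain \<open>Re e\<close> times the scalar product of x and y,
    which cancels and leaves only the squared lengths.\<close>
  then have "Im e * (x \<bullet> x + y \<bullet> y) = 0"
    unfolding Ax Ay using xy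
    by (simp add: minus_scalar_prod_distrib[of _ n] scalar_prod_add_distrib[of _ n] algebra_simps)
  moreover have "x \<noteq> 0\<^sub>v n \<or> y \<noteq> 0\<^sub>v n"
  proof (rule ccontr)
    assume "\<not> ?thesis"
    then have "Re (v $ i) = 0 \<and> Im (v $ i) = 0" if "i < n" for i
      using that v(1) x_def y_def by (metis carrier_vecD index_map_vec(1) index_zero_vec(1))
    then have "v = 0\<^sub>v n" using v(1) by (intro eq_vecI) (auto simp: complex_eq_iff)
    with v show False by simp
  qed
  ultimately have im: "Im e = 0"
    using real_scalar_prod_self_nonneg[of x] real_scalar_prod_self_nonneg[of y]
      real_scalar_prod_self_eq_0[OF xy(1)] real_scalar_prod_self_eq_0[OF xy(2)]
    by (metis add_nonneg_eq_0_iff mult_eq_0_iff)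
  obtain w where w: "w \<in> carrier_vec n" "w \<noteq> 0\<^sub>v n" "A *\<^sub>v w = Re e \<cdot>\<^sub>v w"
  proof (cases "x = 0\<^sub>v n")
    case False
    have "Re e \<cdot>\<^sub>v x - Im e \<cdot>\<^sub>v y = Re e \<cdot>\<^sub>v x"
      using xy im by (intro eq_vecI) auto
    with False show ?thesis using that[of x] Ax xy by simp
  next
    case True
    have "Im e \<cdot>\<^sub>v x + Re e \<cdot>\<^sub>v y = Re e \<cdot>\<^sub>v y"
      using xy im by (intro eq_vecI) auto
    with True \<open>x \<noteq> 0\<^sub>v n \<or> y \<noteq> 0\<^sub>v n\<close> show ?thesis using that[of y] Ay xy by simp
  qed
  show thesis
  proof (rule that)
    show "(1 / sqrt (w \<bullet> w)) \<cdot>\<^sub>v w \<in> carrier_vec n" using w by simp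
    show "((1 / sqrt (w \<bullet> w)) \<cdot>\<^sub>v w) \<bullet> ((1 / sqrt (w \<bullet> w)) \<cdot>\<^sub>v w) = 1"
      by (rule real_normalize[OF w(1,2)])
    show "A *\<^sub>v ((1 / sqrt (w \<bullet> w)) \<cdot>\<^sub>v w) = Re e \<cdot>\<^sub>v ((1 / sqrt (w \<bullet> w)) \<cdot>\<^sub>v w)"
      using mult_mat_vec[OF A w(1)] w by (simp add: smult_smult_assoc mult.commute)
  qed
qed

section \<open>Orthogonal groups over a field\<close>

lemma orthogonal_group_inverse:
  fixes G :: "'a :: field mat"
  assumes "G \<in> orthogonal_group n"
  shows "G \<in> carrier_mat n n" "G\<^sup>T * G = 1\<^sub>m n" "G * G\<^sup>T = 1\<^sub>m n"
  using assms mat_mult_left_right_inverse[of "G\<^sup>T" n G] by (auto simp: orthogonal_group_def)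

lemma orthogonal_group_mult:
  fixes G :: "'a :: field mat"
  assumes "G \<in> orthogonal_group n" "H \<in> orthogonal_group n"
  shows "G * H \<in> orthogonal_group n"
proof -
  note G = orthogonal_group_inverse[OF assms(1)] and H = orthogonal_group_inverse[OF assms(2)]
  have "(G * H)\<^sup>T * (G * H) = H\<^sup>T * (G\<^sup>T * G) * H"
    using G(1) H(1) by (simp add: transpose_mult[of _ n n _ n] assoc_mult_mat[of _ n n _ n _ n])
  also have "\<dots> = 1\<^sub>m n" using G H by simp
  finally show ?thesis using G H by (auto simp: orthogonal_group_def)
qed

lemma orthogonal_group_transpose:
  fixes G :: "'a :: field mat"
  assumes "G \<in> orthogonal_group n"
  shows "G\<^sup>T \<in> orthogonal_group n"
  using orthogonal_group_inverse[OF assms] by (auto simp: orthogonal_group_def)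

text \<open>The Householder reflection along v - e_0 exchanges the unit vectors e_0 and v. When v is
  already e_0 there is nothing to reflect along, and the identity serves.\<close>

lemma unit_vec_first_column_orthogonal:
  fixes v :: "real vec"
  assumes v: "v \<in> carrier_vec n" and v1: "v \<bullet> v = 1" and n: "n > 0"
  obtains W where "W \<in> orthogonal_group n" "col W 0 = v"
proof (cases "v = unit_vec n 0")
  case True
  then show ?thesis using that[of "1\<^sub>m n"] n by (simp add: orthogonal_group_def)
next
  case False
  define u where "u = v - unit_vec n 0"
  define r where "r = u \<bullet> u"
  have u: "u \<in> carrier_vec n" using v by (simp add: u_def)
  have "u \<noteq> 0\<^sub>v n"
  proof
    assume *: "u = 0\<^sub>v n"
    have "v $ i = unit_vec n 0 $ i" if "i < n" for i
      using arg_cong[OF *, of "\<lambda>w. w $ i"] that v by (simp add: u_def)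
    with False v show False by (metis carrier_vecD eq_vecI index_unit_vec(3))
  qed
  then have r0: "r \<noteq> 0" using real_scalar_prod_self_eq_0[OF u] by (simp add: r_def)
  \<comment> \<open>Both vectors have length one, so r equals \<open>- 2 * u $ 0\<close>; this is
    what makes the first column of \<open>W\<close> come out as v.\<close>
  have r: "r = 2 - 2 * v $ 0"
    using v n v1 unfolding r_def u_def
    by (simp add: minus_scalar_prod_distrib[of _ n] scalar_prod_minus_distrib[of _ n])
  have rsum: "r = (\<Sum>k<n. u $ k * u $ k)"
    using u by (simp add: r_def scalar_prod_def lessThan_atLeast0)
  \<comment> \<open>The reflection I - 2 u u^T / (u . u).\<close>
  define W where "W = mat n n (\<lambda>(i, j). of_bool (i = j) - 2 * u $ i * u $ j / r)"
  have W: "W \<in> carrier_mat n n" by (simp add: W_def)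
  have "(\<Sum>k<n. (of_bool (k = i) - 2 * u $ k * u $ i / r) * (of_bool (k = j) - 2 * u $ k * u $ j / r))
      = of_bool (i = j)" if ij: "i < n" "j < n" for i j
  proof -
    have "(\<Sum>k<n. (of_bool (k = i) - 2 * u $ k * u $ i / r) * (of_bool (k = j) - 2 * u $ k * u $ j / r))
      = (\<Sum>k<n. (if k = i then of_bool (i = j) else 0) - (if k = i then 2 * u $ i * u $ j / r else 0)
           - (if k = j then 2 * u $ i * u $ j / r else 0) + 4 * u $ i * u $ j / r\<^sup>2 * (u $ k * u $ k))"
      by (intro sum.cong) (auto simp: algebra_simps power2_eq_square)
    \<comment> \<open>The two Kronecker terms contribute -4 u_i u_j / r in total; the quadratic term
      will cancel it because the squares of the u_k sum to r.\<close>
    also have "\<dots> = of_bool (i = j) - 4 * u $ i * u $ j / r + 4 * u $ i * u $ j / r\<^sup>2 * r"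
      using u ij by (simp add: sum.distrib sum_subtractf rsum
          sum_distrib_left[symmetric] del: times_divide_eq_left)
    also have "\<dots> = of_bool (i = j)" using r0 by (simp add: power2_eq_square)
    finally show ?thesis .
  qed
  then have "W\<^sup>T * W = 1\<^sub>m n"
    by (intro eq_matI) (auto simp: W_def scalar_prod_def lessThan_atLeast0)
  moreover have "col W 0 = v"
  proof (rule eq_vecI)
    fix i assume "i < dim_vec v"
    then have i: "i < n" using v by simp
    have "u $ i = v $ i - of_bool (i = 0)" "u $ 0 = v $ 0 - 1"
      using i n v by (auto simp: u_def)
    moreover have "- 2 * (v $ 0 - 1) / r = 1" using r r0 by (simp add: field_simps)
    moreover have "W $$ (i, 0) = of_bool (i = 0) + u $ i * (- 2 * u $ 0 / r)"
      using i n by (simp add: W_def)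
    ultimately show "col W 0 $ i = v $ i" using i n W by simp
  qed (use v W in auto)
  ultimately show ?thesis using that[of W] W by (simp add: orthogonal_group_def)
qed

text \<open>Deflation: in an orthonormal basis starting with an eigenvector, a symmetric matrix splits
  off that eigenvalue as a one-by-one diagonal block.\<close>

lemma real_symmetric_diagonalization:
  fixes A :: "real mat"
  assumes "A \<in> carrier_mat n n" "A\<^sup>T = A"
  shows "\<exists>U d. U \<in> orthogonal_group n \<and> U\<^sup>T * A * U = mat_diag n d"
  using assms
proof (induction n arbitrary: A)
  case 0
  then show ?case
    by (intro exI[of _ "1\<^sub>m 0"] exI[of _ undefined]) (auto simp: orthogonal_group_def mat_diag_def)
next
  case (Suc n)
  obtain a v where v: "v \<in> carrier_vec (Suc n)" "v \<bullet> v = 1" "A *\<^sub>v v = a \<cdot>\<^sub>v v"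
    by (rule real_symmetric_eigenvector[OF Suc.prems]) auto
  obtain W where W: "W \<in> orthogonal_group (Suc n)" "col W 0 = v"
    by (rule unit_vec_first_column_orthogonal[OF v(1,2)]) auto
  note Wo = orthogonal_group_inverse[OF W(1)]
  define C where "C = W\<^sup>T * A * W"
  have C: "C \<in> carrier_mat (Suc n) (Suc n)" using Wo Suc.prems by (simp add: C_def)
  have Csym: "C\<^sup>T = C"
    using Wo Suc.prems by (simp add: C_def transpose_mult[of _ "Suc n" "Suc n" _ "Suc n"]
        assoc_mult_mat[of _ "Suc n" "Suc n" _ "Suc n" _ "Suc n"])
  have AW: "A * W \<in> carrier_mat (Suc n) (Suc n)" using Wo(1) Suc.prems by simp
  have "C = W\<^sup>T * (A * W)"
    using Wo(1) Suc.prems by (simp add: C_def assoc_mult_mat[of _ "Suc n" "Suc n" _ "Suc n" _ "Suc n"])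
  \<comment> \<open>Column 0 of \<open>W\<close> is the eigenvector v, and the transpose of
    \<open>W\<close> sends it back to the first basis vector.\<close>
  then have "col C 0 = W\<^sup>T *\<^sub>v (a \<cdot>\<^sub>v col W 0)"
    using col_mult2[OF transpose_carrier_mat[THEN iffD2, OF Wo(1)] AW, of 0]
      col_mult2[OF Suc.prems(1) Wo(1), of 0] W(2) v(3) by simp
  also have "\<dots> = a \<cdot>\<^sub>v col (W\<^sup>T * W) 0"
    using mult_mat_vec[OF transpose_carrier_mat[THEN iffD2, OF Wo(1)] col_carrier_vec[OF _ Wo(1)], of 0 a]
      col_mult2[OF transpose_carrier_mat[THEN iffD2, OF Wo(1)] Wo(1), of 0] by simp
  finally have col0: "C $$ (i, 0) = (if i = 0 then a else 0)" if "i < Suc n" for i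
    using that C Wo by (auto simp: vec_eq_iff)
  \<comment> \<open>Symmetry of \<open>C\<close> carries the zeros from the first column to the
    first row, so \<open>C\<close> is block diagonal.\<close>
  then have row0: "C $$ (0, i) = (if i = 0 then a else 0)" if "i < Suc n" for i
    using that C Csym by (metis carrier_matD index_transpose_mat(1) zero_less_Suc)
  define A' where "A' = mat n n (\<lambda>(i, j). C $$ (Suc i, Suc j))"
  have A': "A' \<in> carrier_mat n n" by (simp add: A'_def)
  have "A'\<^sup>T = A'"
    by (intro eq_matI) (use C Csym in \<open>auto simp: A'_def\<close>,
        metis Suc_less_eq carrier_matD index_transpose_mat(1))
  from Suc.IH[OF A' this] obtain U' d' where
    U': "U' \<in> orthogonal_group n" "U'\<^sup>T * A' * U' = mat_diag n d'" by blast
  note Uo = orthogonal_group_inverse[OF U'(1)]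
  define E where "E = four_block_mat (a \<cdot>\<^sub>m 1\<^sub>m 1) (0\<^sub>m 1 n) (0\<^sub>m n 1) A'"
  define X where "X = four_block_mat (1\<^sub>m 1) (0\<^sub>m 1 n) (0\<^sub>m n 1) U'"
  have CE: "C = E"
    by (intro eq_matI) (use C A' in \<open>auto simp: E_def A'_def col0 row0 less_Suc_eq_0_disj\<close>)
  have X: "X \<in> carrier_mat (Suc n) (Suc n)" using Uo by (auto simp: X_def)
  have XT: "X\<^sup>T = four_block_mat (1\<^sub>m 1) (0\<^sub>m 1 n) (0\<^sub>m n 1) (U'\<^sup>T)"
    using Uo by (simp add: X_def transpose_four_block_mat[of _ 1 1 _ n _ n])
  have "X\<^sup>T * X = 1\<^sub>m (Suc n)"
    unfolding XT unfolding X_def using Uo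
    by (subst mult_four_block_mat[of _ 1 1 _ n _ n]) auto
  then have Xo: "X \<in> orthogonal_group (Suc n)" using X by (simp add: orthogonal_group_def)
  have "X\<^sup>T * E * X = four_block_mat (a \<cdot>\<^sub>m 1\<^sub>m 1) (0\<^sub>m 1 n) (0\<^sub>m n 1) (U'\<^sup>T * A' * U')"
    unfolding XT unfolding X_def E_def using Uo A'
    by (simp add: mult_four_block_mat[of _ 1 1 _ n _ n _ _ 1 _ n])
  also have "\<dots> = mat_diag (Suc n) (case_nat a d')"
    unfolding U'(2) by (intro eq_matI) (auto simp: mat_diag_def split: nat.split)
  finally have "(W * X)\<^sup>T * A * (W * X) = mat_diag (Suc n) (case_nat a d')"
    using Wo(1) X Suc.prems unfolding CE[symmetric] C_def
    by (simp add: transpose_mult[of _ "Suc n" "Suc n" _ "Suc n"]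
        assoc_mult_mat[of _ "Suc n" "Suc n" _ "Suc n" _ "Suc n"])
  then show ?case using orthogonal_group_mult[OF W(1) Xo] by blast
qed

section \<open>Anticommuting real and imaginary parts\<close>

text \<open>Lists are used because the families are concatenated from blocks and a position later
  becomes a column index.\<close>

definition orthonormal_list :: "nat \<Rightarrow> real vec list \<Rightarrow> bool" where
  "orthonormal_list n vs \<longleftrightarrow> set vs \<subseteq> carrier_vec n \<and>
     (\<forall>i<length vs. \<forall>j<length vs. vs ! i \<bullet> vs ! j = of_bool (i = j))"

lemma orthonormal_list_append:
  assumes "orthonormal_list n vs" "orthonormal_list n ws"
    and "\<And>v w. v \<in> set vs \<Longrightarrow> w \<in> set ws \<Longrightarrow> v \<bullet> w = 0"
  shows "orthonormal_list n (vs @ ws)"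
proof -
  have c: "v \<in> carrier_vec n" if "v \<in> set vs \<union> set ws" for v
    using assms that by (auto simp: orthonormal_list_def)
  have 1: "vs ! i \<bullet> ws ! j = 0" if "i < length vs" "j < length ws" for i j
    using assms(3) that by simp
  have 2: "ws ! j \<bullet> vs ! i = 0" if "i < length vs" "j < length ws" for i j
    using 1[OF that] comm_scalar_prod[of "vs ! i" n "ws ! j"] c that by simp
  show ?thesis
    using assms(1,2) unfolding orthonormal_list_def by (auto simp: nth_append 1 2)
qed

lemma orthonormal_list_map:
  assumes "distinct is" "\<And>i. i \<in> set is \<Longrightarrow> u i \<in> carrier_vec n"
    and "\<And>i j. i \<in> set is \<Longrightarrow> j \<in> set is \<Longrightarrow> u i \<bullet> u j = of_bool (i = j)"
  shows "orthonormal_list n (map u is)"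
  using assms by (auto simp: orthonormal_list_def nth_eq_iff_index_eq)

lemma orthonormal_list_gram:
  assumes "orthonormal_list n vs"
  shows "(mat_of_cols n vs)\<^sup>T * mat_of_cols n vs = 1\<^sub>m (length vs)"
proof (rule eq_matI)
  fix i j assume "i < dim_row (1\<^sub>m (length vs))" "j < dim_col (1\<^sub>m (length vs))"
  then show "((mat_of_cols n vs)\<^sup>T * mat_of_cols n vs) $$ (i, j) = 1\<^sub>m (length vs) $$ (i, j)"
    using assms by (auto simp: orthonormal_list_def subset_iff)
qed auto

text \<open>Padding more than \<open>n\<close> orthonormal columns with zero rows would give a
  square matrix with a left inverse but a zero row.\<close>

lemma orthonormal_list_length_le:
  assumes "orthonormal_list n vs"
  shows "length vs \<le> n"
proof (rule ccontr)
  assume "\<not> ?thesis"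
  define m where "m = length vs"
  with \<open>\<not> ?thesis\<close> have m: "n < m" by simp
  define X where "X = mat m m (\<lambda>(i, j). if i < n then (vs ! j) $ i else 0)"
  have X: "X \<in> carrier_mat m m" by (simp add: X_def)
  have "X\<^sup>T * X = 1\<^sub>m m"
  proof (rule eq_matI)
    fix i j assume "i < dim_row (1\<^sub>m m)" "j < dim_col (1\<^sub>m m)"
    then have ij: "i < m" "j < m" by auto
    have d: "dim_vec (vs ! j) = n" using assms ij by (auto simp: orthonormal_list_def m_def subset_iff)
    have "(X\<^sup>T * X) $$ (i, j) = (\<Sum>k = 0..<m. X $$ (k, i) * X $$ (k, j))"
      using ij X by (simp add: scalar_prod_def)
    also have "\<dots> = (\<Sum>k = 0..<n. vs ! i $ k * vs ! j $ k)"
      using m ij by (intro sum.mono_neutral_cong_right) (auto simp: X_def)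
    also have "\<dots> = vs ! i \<bullet> vs ! j" using d by (simp add: scalar_prod_def)
    also have "\<dots> = of_bool (i = j)" using assms ij by (simp add: orthonormal_list_def m_def)
    finally show "(X\<^sup>T * X) $$ (i, j) = 1\<^sub>m m $$ (i, j)" using ij by simp
  qed (use X in auto)
  then have "X * X\<^sup>T = 1\<^sub>m m" using mat_mult_left_right_inverse[of "X\<^sup>T" m X] X by simp
  moreover have "(X * X\<^sup>T) $$ (n, n) = 0"
    using m X by (auto simp: scalar_prod_def X_def)
  ultimately show False using m by simp
qed

lemma orthonormal_list_orthogonal_group:
  assumes "orthonormal_list n vs" "length vs = n"
  shows "mat_of_cols n vs \<in> orthogonal_group n"
  using orthonormal_list_gram[OF assms(1)] mat_of_cols_carrier(1)[of n vs] assms(2)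
  by (simp add: orthogonal_group_def)

lemma square_minus_1_pos:
  fixes a :: real
  assumes "\<bar>a\<bar> > 1"
  shows "a\<^sup>2 - 1 > 0"
  using power_strict_mono[OF assms, of 2] by simp

text \<open>The real and imaginary parts of a complex symmetric involution form such a pair.\<close>

definition hyperbolic_pair :: "nat \<Rightarrow> real mat \<Rightarrow> real mat \<Rightarrow> bool" where
  "hyperbolic_pair n A B \<longleftrightarrow> A \<in> carrier_mat n n \<and> B \<in> carrier_mat n n \<and>
     A\<^sup>T = A \<and> B\<^sup>T = B \<and> A * A = 1\<^sub>m n + B * B \<and> A * B = - (B * A)"

text \<open>Negating \<open>A\<close> swaps eigenvalues above 1 with those below -1, so a bound for
  one class yields the bound for the other.\<close>

lemma hyperbolic_pair_uminus:
  "hyperbolic_pair n A B \<Longrightarrow> hyperbolic_pair n (- A) B"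
  by (auto simp: hyperbolic_pair_def transpose_uminus)

definition eig :: "nat \<Rightarrow> real mat \<Rightarrow> real \<Rightarrow> real vec \<Rightarrow> bool" where
  "eig n A a x \<longleftrightarrow> x \<in> carrier_vec n \<and> A *\<^sub>v x = a \<cdot>\<^sub>v x"

lemma hyperbolic_pairD:
  assumes "hyperbolic_pair n A B"
  shows "A \<in> carrier_mat n n" "B \<in> carrier_mat n n" "A\<^sup>T = A" "B\<^sup>T = B"
    "A * A = 1\<^sub>m n + B * B" "A * B = - (B * A)"
  using assms by (simp_all add: hyperbolic_pair_def)

text \<open>The squared length of \<open>B *\<^sub>v x\<close> is a^2 - 1 times that of x, so the
  factor restores the length when |a| > 1. The minus sign produces the entries -sinh that M(2
  \<theta>) J requires.\<close>

definition partner :: "real mat \<Rightarrow> real \<Rightarrow> real vec \<Rightarrow> real vec" where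
  "partner B a x = (- 1 / sqrt (a\<^sup>2 - 1)) \<cdot>\<^sub>v (B *\<^sub>v x)"

text \<open>Replacing the eigenvectors with eigenvalue below \<open>-1\<close> by the partners of those with eigenvalue
  above \<open>1\<close> keeps the family orthonormal. Bounding its length by \<open>n\<close> compares the two counts.\<close>

definition paired_basis ::
  "real mat \<Rightarrow> nat list \<Rightarrow> nat list \<Rightarrow> nat list \<Rightarrow> (nat \<Rightarrow> real) \<Rightarrow> (nat \<Rightarrow> real vec) \<Rightarrow> real vec list" where
  "paired_basis B I K N d u =
     map u I @ map u K @ map (\<lambda>i. partner B (d i) (u i)) I @ map u N"

definition mat_trace :: "'a :: comm_monoid_add mat \<Rightarrow> 'a" where
  "mat_trace M = (\<Sum>i<dim_row M. M $$ (i, i))"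

lemma mat_trace_mult_comm:
  fixes X Y :: "'a :: comm_semiring_0 mat"
  assumes "X \<in> carrier_mat m k" "Y \<in> carrier_mat k m"
  shows "mat_trace (X * Y) = mat_trace (Y * X)"
proof -
  have "mat_trace (X * Y) = (\<Sum>i<m. \<Sum>j<k. X $$ (i, j) * Y $$ (j, i))"
    using assms by (simp add: mat_trace_def scalar_prod_def lessThan_atLeast0)
  also have "\<dots> = (\<Sum>j<k. \<Sum>i<m. Y $$ (j, i) * X $$ (i, j))"
    by (subst sum.swap) (simp add: mult.commute)
  also have "\<dots> = mat_trace (Y * X)"
    using assms by (simp add: mat_trace_def scalar_prod_def lessThan_atLeast0)
  finally show ?thesis .
qed

lemma length_filter_split:
  fixes d :: "nat \<Rightarrow> real"
  assumes "\<And>i. i \<in> set xs \<Longrightarrow> \<bar>d i\<bar> \<ge> 1"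
  shows "length xs = length (filter (\<lambda>i. d i > 1) xs) + length (filter (\<lambda>i. d i = 1) xs)
    + length (filter (\<lambda>i. d i = - 1) xs) + length (filter (\<lambda>i. d i < - 1) xs)"
  using assms
proof (induction xs)
  case (Cons a xs)
  then have "\<bar>d a\<bar> \<ge> 1" by simp
  then consider "d a > 1" | "d a = 1" | "d a = - 1" | "d a < - 1" by linarith
  then show ?case using Cons by cases auto
qed simp

text \<open>Here \<open>t k\<close> is the doubled angle \<open>2 \<theta>\<^sub>k\<close>.\<close>

definition canonical_basis ::
  "nat \<Rightarrow> real mat \<Rightarrow> real mat \<Rightarrow> nat \<Rightarrow> nat \<Rightarrow> (nat \<Rightarrow> real vec) \<Rightarrow> (nat \<Rightarrow> real) \<Rightarrow> bool" where
  "canonical_basis n A B p q f t \<longleftrightarrow>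
     (\<forall>k<q. A *\<^sub>v f k = cosh (t k) \<cdot>\<^sub>v f k \<and> B *\<^sub>v f k = - sinh (t k) \<cdot>\<^sub>v f (p + k) \<and>
        A *\<^sub>v f (p + k) = - cosh (t k) \<cdot>\<^sub>v f (p + k) \<and> B *\<^sub>v f (p + k) = - sinh (t k) \<cdot>\<^sub>v f k) \<and>
     (\<forall>k. q \<le> k \<and> k < p \<longrightarrow> A *\<^sub>v f k = f k \<and> B *\<^sub>v f k = 0\<^sub>v n)"

section \<open>Action of the pair on eigenvectors of the real part\<close>

text \<open>Moving the symmetric \<open>A\<close> across the scalar product gives (a - b) (x . y) =
  0.\<close>

lemma eig_orthogonal:
  assumes hyperbolic: "hyperbolic_pair n A B"
    and "eig n A a x" "eig n A b y" "a \<noteq> b"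
  shows "x \<bullet> y = 0"
  using assms hyperbolic_pairD(1,3)[OF hyperbolic] symmetric_mat_scalar_prod[of A n x y]
  by (auto simp: eig_def)

text \<open>Anticommutation gives A B x = - B A x = - a B x.\<close>

lemma eig_B:
  assumes hyperbolic: "hyperbolic_pair n A B"
    and "eig n A a x"
  shows "eig n A (- a) (B *\<^sub>v x)"
proof -
  note A = hyperbolic_pairD(1)[OF hyperbolic] and B = hyperbolic_pairD(2)[OF hyperbolic]
    and anticommute = hyperbolic_pairD(6)[OF hyperbolic]
  have x: "x \<in> carrier_vec n" "A *\<^sub>v x = a \<cdot>\<^sub>v x" using assms by (auto simp: eig_def)
  have "A *\<^sub>v (B *\<^sub>v x) = (A * B) *\<^sub>v x" using A B x by simp
  also have "\<dots> = - (B *\<^sub>v (A *\<^sub>v x))" unfolding anticommute using A B x(1) by simp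
  also have "\<dots> = - a \<cdot>\<^sub>v (B *\<^sub>v x)"
    unfolding x(2) using B x(1) by (auto simp: mult_mat_vec[OF B x(1)])
  finally show ?thesis using B x by (simp add: eig_def)
qed

text \<open>On an eigenvector, \<open>A * A = 1\<^sub>m n + B * B\<close> reads a^2 x = x + B B
  x.\<close>

lemma eig_B_B:
  assumes hyperbolic: "hyperbolic_pair n A B"
    and "eig n A a x"
  shows "B *\<^sub>v (B *\<^sub>v x) = (a\<^sup>2 - 1) \<cdot>\<^sub>v x"
proof -
  note A = hyperbolic_pairD(1)[OF hyperbolic] and B = hyperbolic_pairD(2)[OF hyperbolic]
    and A_square = hyperbolic_pairD(5)[OF hyperbolic]
  have x: "x \<in> carrier_vec n" "A *\<^sub>v x = a \<cdot>\<^sub>v x" using assms by (auto simp: eig_def)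
  have "a\<^sup>2 \<cdot>\<^sub>v x = A *\<^sub>v (A *\<^sub>v x)"
    using x by (simp add: mult_mat_vec[OF A x(1)] smult_smult_assoc power2_eq_square)
  also have "\<dots> = (A * A) *\<^sub>v x" using A x(1) by simp
  also have "\<dots> = x + B *\<^sub>v (B *\<^sub>v x)"
    unfolding A_square using B x(1) by (simp add: add_mult_distrib_mat_vec[of _ n n])
  finally have *: "a\<^sup>2 \<cdot>\<^sub>v x = x + B *\<^sub>v (B *\<^sub>v x)" .
  show ?thesis
  proof (rule eq_vecI)
    fix i assume "i < dim_vec ((a\<^sup>2 - 1) \<cdot>\<^sub>v x)"
    then have i: "i < n" using x by simp
    show "(B *\<^sub>v (B *\<^sub>v x)) $ i = ((a\<^sup>2 - 1) \<cdot>\<^sub>v x) $ i"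
      using arg_cong[OF *, of "\<lambda>v. v $ i"] i B x(1)
      by (simp add: algebra_simps del: index_mult_mat_vec)
  qed (use x B in auto)
qed

text \<open>\<open>B\<close> is symmetric, so both factors \<open>B\<close> can be moved onto y,
  where they act as the scalar b^2 - 1. Hence \<open>B\<close> is a scaled isometry on each
  eigenspace.\<close>

lemma eig_B_scalar_prod:
  assumes hyperbolic: "hyperbolic_pair n A B"
    and "eig n A a x" "eig n A b y"
  shows "(B *\<^sub>v x) \<bullet> (B *\<^sub>v y) = (b\<^sup>2 - 1) * (x \<bullet> y)"
proof -
  note B = hyperbolic_pairD(2)[OF hyperbolic] and B_sym = hyperbolic_pairD(4)[OF hyperbolic]
  have xy: "x \<in> carrier_vec n" "y \<in> carrier_vec n" using assms by (auto simp: eig_def)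
  have "(B *\<^sub>v x) \<bullet> (B *\<^sub>v y) = x \<bullet> (B *\<^sub>v (B *\<^sub>v y))"
    using symmetric_mat_scalar_prod[OF B B_sym xy(1), of "B *\<^sub>v y"] B xy by simp
  then show ?thesis using eig_B_B[OF hyperbolic assms(3)] xy by simp
qed

text \<open>The squared length of \<open>B *\<^sub>v x\<close> is a^2 - 1 and cannot be
  negative.\<close>

lemma eig_ge_1:
  assumes hyperbolic: "hyperbolic_pair n A B"
    and "eig n A a x" "x \<bullet> x = 1"
  shows "\<bar>a\<bar> \<ge> 1"
  using eig_B_scalar_prod[OF hyperbolic assms(2) assms(2)] assms(3)
    real_scalar_prod_self_nonneg[of "B *\<^sub>v x"]
  by (metis abs_le_square_iff abs_one diff_ge_0_iff_ge mult.right_neutral power_one)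

text \<open>Here the squared length of \<open>B *\<^sub>v x\<close> is zero.\<close>

lemma eig_1_B:
  assumes hyperbolic: "hyperbolic_pair n A B"
    and "eig n A a x" "\<bar>a\<bar> = 1"
  shows "B *\<^sub>v x = 0\<^sub>v n"
proof -
  note B = hyperbolic_pairD(2)[OF hyperbolic]
  have "a\<^sup>2 = 1" using assms(3) by (simp add: abs_square_eq_1)
  then have "(B *\<^sub>v x) \<bullet> (B *\<^sub>v x) = 0" using eig_B_scalar_prod[OF hyperbolic assms(2) assms(2)] by simp
  moreover have "B *\<^sub>v x \<in> carrier_vec n" using B assms(2) by (simp add: eig_def)
  ultimately show ?thesis using real_scalar_prod_self_eq_0 by blast
qed

lemma eig_smult:
  assumes "hyperbolic_pair n A B" "eig n A a x"
  shows "eig n A a (c \<cdot>\<^sub>v x)"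
  using assms(2) by (auto simp: eig_def mult_mat_vec[OF hyperbolic_pairD(1)[OF assms(1)]]
      smult_smult_assoc mult.commute)

lemma eig_partner:
  assumes "hyperbolic_pair n A B" "eig n A a x"
  shows "eig n A (- a) (partner B a x)"
  unfolding partner_def by (rule eig_smult[OF assms(1) eig_B[OF assms]])

lemma B_eq_partner:
  assumes hyperbolic: "hyperbolic_pair n A B"
    and "eig n A a x" "\<bar>a\<bar> > 1"
  shows "B *\<^sub>v x = - sqrt (a\<^sup>2 - 1) \<cdot>\<^sub>v partner B a x"
proof -
  have "a\<^sup>2 - 1 > 0" by (rule square_minus_1_pos[OF assms(3)])
  then show ?thesis by (simp add: partner_def smult_smult_assoc)
qed

lemma B_partner:
  assumes hyperbolic: "hyperbolic_pair n A B"
    and "eig n A a x" "\<bar>a\<bar> > 1"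
  shows "B *\<^sub>v partner B a x = - sqrt (a\<^sup>2 - 1) \<cdot>\<^sub>v x"
proof -
  note B = hyperbolic_pairD(2)[OF hyperbolic]
  have "a\<^sup>2 - 1 > 0" by (rule square_minus_1_pos[OF assms(3)])
  moreover have "B *\<^sub>v x \<in> carrier_vec n" using B assms(2) by (simp add: eig_def)
  ultimately show ?thesis
    by (simp add: partner_def mult_mat_vec[OF B] eig_B_B[OF hyperbolic assms(2)] smult_smult_assoc real_div_sqrt)
qed

text \<open>For equal eigenvalues the normalizing factors cancel a^2 - 1; for different ones both
  sides vanish, since the negated eigenvalues differ as well.\<close>

lemma partner_scalar_prod:
  assumes hyperbolic: "hyperbolic_pair n A B"
    and "eig n A a x" "eig n A b y" "\<bar>a\<bar> > 1"
  shows "partner B a x \<bullet> partner B b y = x \<bullet> y"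
proof (cases "a = b")
  case False
  with eig_orthogonal[OF hyperbolic eig_partner[OF hyperbolic assms(2)] eig_partner[OF hyperbolic assms(3)]]
    eig_orthogonal[OF hyperbolic assms(2,3)]
  show ?thesis by simp
next
  case True
  have "B *\<^sub>v x \<in> carrier_vec n" "B *\<^sub>v y \<in> carrier_vec n"
    using assms(2,3) hyperbolic_pairD(2)[OF hyperbolic] by (auto simp: eig_def)
  then show ?thesis
    using True square_minus_1_pos[OF assms(4)] eig_B_scalar_prod[OF hyperbolic assms(2,3)]
    by (simp add: partner_def)
qed

section \<open>Counting eigenvalues and building the canonical basis\<close>

text \<open>The four blocks have eigenvalues above 1, equal to 1, below -1 and equal to -1, so
  vectors of different blocks are orthogonal. Inside the third block, passing to partners preserves
  scalar products.\<close>

lemma orthonormal_paired_basis: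
  assumes hyperbolic: "hyperbolic_pair n A B"
    and ev: "\<And>i. i \<in> set (I @ K @ N) \<Longrightarrow> eig n A (d i) (u i)"
    and on: "\<And>i j. i \<in> set (I @ K @ N) \<Longrightarrow> j \<in> set (I @ K @ N) \<Longrightarrow> u i \<bullet> u j = of_bool (i = j)"
    and I: "\<And>i. i \<in> set I \<Longrightarrow> d i > 1" and K: "\<And>i. i \<in> set K \<Longrightarrow> d i = 1"
    and N: "\<And>i. i \<in> set N \<Longrightarrow> d i = - 1"
    and dist: "distinct I" "distinct K" "distinct N"
  shows "orthonormal_list n (paired_basis B I K N d u)"
proof -
  have carrier: "u i \<in> carrier_vec n" if "i \<in> set (I @ K @ N)" for i
    using ev[OF that] by (simp add: eig_def)
  have "orthonormal_list n (map (\<lambda>i. partner B (d i) (u i)) I)"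
  proof (rule orthonormal_list_map)
    fix i j assume ij: "i \<in> set I" "j \<in> set I"
    then show "partner B (d i) (u i) \<bullet> partner B (d j) (u j) = of_bool (i = j)"
      using partner_scalar_prod[OF hyperbolic, of "d i" "u i" "d j" "u j"] ev on I[of i] by simp
    show "partner B (d i) (u i) \<in> carrier_vec n"
      using eig_partner[OF hyperbolic, of "d i" "u i"] ev ij by (simp add: eig_def)
  qed (rule dist)
  moreover have "orthonormal_list n (map u L)" if "set L \<subseteq> set (I @ K @ N)" "distinct L" for L
    using that on carrier by (intro orthonormal_list_map) blast+
  moreover have "v \<bullet> w = 0" if "eig n A a v" "eig n A b w" "a \<noteq> b" for v w a b
    using eig_orthogonal[OF hyperbolic that] .
  ultimately show ?thesis
    unfolding paired_basis_def
  \<comment> \<open>Goals 5 to 7 are the cross products of the nested append: partners against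
    \<open>N\<close>, then \<open>K\<close> against all that follows, then \<open>I\<close> against
    all that follows.\<close>
  proof (intro orthonormal_list_append, goal_cases)
    case (5 v w)
    then obtain i j where "v = partner B (d i) (u i)" "w = u j" "i \<in> set I" "j \<in> set N" by auto
    then show ?case
      using eig_orthogonal[OF hyperbolic eig_partner[OF hyperbolic ev[of i]] ev[of j]] I[of i] N[of j] by force
  next
    case (6 v w)
    then obtain i where v: "v = u i" "i \<in> set K" by auto
    from 6 consider j where "w = partner B (d j) (u j)" "j \<in> set I" | j where "w = u j" "j \<in> set N"
      by auto
    then show ?case
    proof cases
      case (1 j)
      then show ?thesis
        using v eig_orthogonal[OF hyperbolic ev[of i] eig_partner[OF hyperbolic ev[of j]]] I[of j] K[of i] by force
    next
      case (2 j)
      then show ?thesis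
        using v eig_orthogonal[OF hyperbolic ev[of i] ev[of j]] N[of j] K[of i] by force
    qed
  next
    case (7 v w)
    then obtain i where v: "v = u i" "i \<in> set I" by auto
    from 7 consider j where "w = partner B (d j) (u j)" "j \<in> set I" | j where "w = u j" "j \<in> set K"
      | j where "w = u j" "j \<in> set N"
      by auto
    then show ?case
    proof cases
      case (1 j)
      then show ?thesis
        using v eig_orthogonal[OF hyperbolic ev[of i] eig_partner[OF hyperbolic ev[of j]]] I[of j] I[of i] by force
    next
      case (2 j)
      then show ?thesis
        using v eig_orthogonal[OF hyperbolic ev[of i] ev[of j]] K[of j] I[of i] by force
    next
      case (3 j)
      then show ?thesis
        using v eig_orthogonal[OF hyperbolic ev[of i] ev[of j]] N[of j] I[of i] by force
    qed
  qed (use dist in auto)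
qed

text \<open>The paired family has 2 |I| + |K| + |N| members, at most n, whereas n is |I| + |K| + |N|
  plus the number of eigenvalues below -1.\<close>

lemma eigenvalue_count_le:
  assumes hyperbolic: "hyperbolic_pair n A B"
    and ev: "\<And>i. i < n \<Longrightarrow> eig n A (d i) (u i)"
    and on: "\<And>i j. i < n \<Longrightarrow> j < n \<Longrightarrow> u i \<bullet> u j = of_bool (i = j)"
  shows "length (filter (\<lambda>i. d i > 1) [0..<n]) \<le> length (filter (\<lambda>i. d i < - 1) [0..<n])"
proof -
  let ?I = "filter (\<lambda>i. d i > 1) [0..<n]" and ?K = "filter (\<lambda>i. d i = 1) [0..<n]"
    and ?N = "filter (\<lambda>i. d i = - 1) [0..<n]"
  have "orthonormal_list n (paired_basis B ?I ?K ?N d u)"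
    using ev on by (intro orthonormal_paired_basis[OF hyperbolic]) auto
  then have "length (paired_basis B ?I ?K ?N d u) \<le> n" by (rule orthonormal_list_length_le)
  moreover have "\<bar>d i\<bar> \<ge> 1" if "i < n" for i
    using eig_ge_1[OF hyperbolic ev[OF that]] on[OF that that] by simp
  then have "n = length ?I + length ?K + length ?N + length (filter (\<lambda>i. d i < - 1) [0..<n])"
    using length_filter_split[of "[0..<n]" d] by simp
  ultimately show ?thesis by (simp add: paired_basis_def)
qed

text \<open>The bound for the pair (-A, B), which has the same eigenvectors, is the reverse
  inequality.\<close>

lemma eigenvalue_count_eq:
  assumes hyp: "hyperbolic_pair n A B"
    and ev: "\<And>i. i < n \<Longrightarrow> eig n A (d i) (u i)"
    and on: "\<And>i j. i < n \<Longrightarrow> j < n \<Longrightarrow> u i \<bullet> u j = of_bool (i = j)"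
  shows "length (filter (\<lambda>i. d i > 1) [0..<n]) = length (filter (\<lambda>i. d i < - 1) [0..<n])"
proof (rule antisym)
  have ev': "eig n (- A) (- d i) (u i)" if "i < n" for i
    using ev[OF that] hyperbolic_pairD(1)[OF hyp] by (auto simp: eig_def)
  have "(\<lambda>i. 1 < - d i) = (\<lambda>i. d i < - 1)" "(\<lambda>i. - d i < - 1) = (\<lambda>i. d i > 1)" by auto
  with eigenvalue_count_le[OF hyperbolic_pair_uminus[OF hyp], of "\<lambda>i. - d i" u, OF ev' on]
  show "length (filter (\<lambda>i. d i < - 1) [0..<n]) \<le> length (filter (\<lambda>i. d i > 1) [0..<n])"
    by simp
qed (rule eigenvalue_count_le[OF assms])

text \<open>Here m counts the eigenvalues above 1 (equally those below -1), and r and s count the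
  eigenvalues 1 and -1. In the order of \<open>paired_basis\<close> a vector and its partner are m +
  r places apart, so m + r and m + s take the roles of p and q. Eigenvectors for -1 are matched with
  eigenvectors for 1, which requires s <= r; the sum of quadratic forms is recorded so that the
  trace can settle r - s later.\<close>

lemma ex_canonical_basis_counts:
  assumes hyperbolic: "hyperbolic_pair n A B"
  shows "\<exists>fs m r s t. orthonormal_list n fs \<and> length fs = n \<and> n = (m + r) + (m + s) \<and>
    (s \<le> r \<longrightarrow> canonical_basis n A B (m + r) (m + s) ((!) fs) t) \<and>
    (\<Sum>k<n. fs ! k \<bullet> (A *\<^sub>v fs ! k)) = real r - real s"
proof -
  note A = hyperbolic_pairD(1)[OF hyperbolic] and A_sym = hyperbolic_pairD(3)[OF hyperbolic]
  note eig_ge_1 = eig_ge_1[OF hyperbolic] and eig_1_B = eig_1_B[OF hyperbolic]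
    and eig_partner = eig_partner[OF hyperbolic]
    and B_eq_partner = B_eq_partner[OF hyperbolic] and B_partner = B_partner[OF hyperbolic]
  obtain U d where U: "U \<in> orthogonal_group n" "U\<^sup>T * A * U = mat_diag n d"
    using real_symmetric_diagonalization[OF A A_sym] by blast
  note Uo = orthogonal_group_inverse[OF U(1)]
  have AU: "A * U = U * mat_diag n d"
  proof -
    have "U * (U\<^sup>T * A * U) = (U * U\<^sup>T) * (A * U)"
      using Uo(1) A by (simp add: assoc_mult_mat[of _ n n _ n _ n])
    then show ?thesis using Uo(1,3) A U(2) by simp
  qed
  have ev: "eig n A (d i) (col U i)" if "i < n" for i
  proof -
    have "A *\<^sub>v col U i = col (U * mat_diag n d) i"
      by (simp only: AU[symmetric] col_mult2[OF A Uo(1) that])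
    also have "\<dots> = d i \<cdot>\<^sub>v col U i"
      using that Uo(1) by (auto simp: mat_diag_mult_right[OF Uo(1)])
    finally show ?thesis using that Uo(1) by (simp add: eig_def)
  qed
  have on: "col U i \<bullet> col U j = of_bool (i = j)" if "i < n" "j < n" for i j
  proof -
    have "col U i \<bullet> col U j = (U\<^sup>T * U) $$ (i, j)" using that Uo(1) by simp
    then show ?thesis using that Uo(2) by simp
  qed
  define I K N where "I = filter (\<lambda>i. d i > 1) [0..<n]" and "K = filter (\<lambda>i. d i = 1) [0..<n]"
    and "N = filter (\<lambda>i. d i = - 1) [0..<n]"
  define m r s where "m = length I" and "r = length K" and "s = length N"
  define fs where "fs = paired_basis B I K N d (col U)"
  \<comment> \<open>A pair with eigenvalues a and -a gets the angle with cosh equal to a. A matched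
    pair with eigenvalues 1 and -1 gets angle 0, in accordance with \<open>B\<close> vanishing on
    it.\<close>
  define t where "t k = (if k < m then arcosh (d (I ! k)) else 0)" for k
  have onl: "orthonormal_list n fs"
    unfolding fs_def using ev on by (intro orthonormal_paired_basis[OF hyperbolic]) (auto simp: I_def K_def N_def)
  have "\<bar>d i\<bar> \<ge> 1" if "i < n" for i
    using eig_ge_1[OF ev[OF that]] on[OF that that] by simp
  then have n: "n = (m + r) + (m + s)"
    using length_filter_split[of "[0..<n]" d] eigenvalue_count_eq[OF hyperbolic, of d "col U"] ev on
    by (simp add: m_def r_def s_def I_def K_def N_def)
  have len: "length fs = n"
    unfolding n by (simp add: fs_def paired_basis_def m_def r_def s_def)
  have nI: "I ! k < n" "d (I ! k) > 1" if "k < m" for k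
    using nth_mem[of k I] that by (auto simp: m_def I_def)
  have nK: "K ! k < n" "d (K ! k) = 1" if "k < r" for k
    using nth_mem[of k K] that by (auto simp: r_def K_def)
  have nN: "N ! k < n" "d (N ! k) = - 1" if "k < s" for k
    using nth_mem[of k N] that by (auto simp: s_def N_def)
  have f1: "fs ! k = col U (I ! k)" if "k < m" for k
    using that by (simp add: fs_def paired_basis_def m_def nth_append)
  have f2: "fs ! (m + k) = col U (K ! k)" if "k < r" for k
    using that by (simp add: fs_def paired_basis_def m_def r_def nth_append)
  have f3: "fs ! (m + r + k) = partner B (d (I ! k)) (col U (I ! k))" if "k < m" for k
    using that by (simp add: fs_def paired_basis_def m_def r_def nth_append)
  have f4: "fs ! (m + r + (m + k)) = col U (N ! k)" if "k < s" for k
    using that by (simp add: fs_def paired_basis_def m_def r_def s_def nth_append)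
  have e1: "eig n A (d (I ! k)) (fs ! k)" if "k < m" for k using f1 nI ev that by simp
  have e2: "eig n A 1 (fs ! (m + k))" if "k < r" for k using f2 nK ev that by metis
  have e3: "eig n A (- d (I ! k)) (fs ! (m + r + k))" if "k < m" for k
    using f3 nI ev eig_partner that by simp
  have e4: "eig n A (- 1) (fs ! (m + r + (m + k)))" if "k < s" for k using f4 nN ev that by metis
  \<comment> \<open>On a unit eigenvector the quadratic form of \<open>A\<close> is the
    eigenvalue.\<close>
  have sq: "fs ! k \<bullet> (A *\<^sub>v fs ! k) = a" if "k < n" "eig n A a (fs ! k)" for k a
    using that onl len by (simp add: orthonormal_list_def eig_def)
  have "(\<Sum>k<n. fs ! k \<bullet> (A *\<^sub>v fs ! k)) = real r - real s"
  proof -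
    have split: "(\<Sum>k<a + b. g k) = (\<Sum>k<a. g k) + (\<Sum>k<b. g (a + k))" for a b and g :: "nat \<Rightarrow> real"
      by (induction b) auto
    \<comment> \<open>Each eigenvalue above 1 cancels against that of its partner, leaving r ones
      and s minus ones.\<close>
    have "(\<Sum>k<n. fs ! k \<bullet> (A *\<^sub>v fs ! k)) =
       (\<Sum>k<m. d (I ! k)) + (\<Sum>k<r. 1) + ((\<Sum>k<m. - d (I ! k)) + (\<Sum>k<s. - 1))"
      unfolding n split
      by (intro arg_cong2[of _ _ _ _ "(+)"] sum.cong refl sq e1 e2 e3 e4) (auto simp: n)
    then show ?thesis by (simp add: sum_negf)
  qed
  moreover have "canonical_basis n A B (m + r) (m + s) ((!) fs) t" if sr: "s \<le> r"
    unfolding canonical_basis_def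
  proof (intro conjI allI impI)
    fix k assume k: "k < m + s"
    have "A *\<^sub>v fs ! k = cosh (t k) \<cdot>\<^sub>v fs ! k \<and> B *\<^sub>v fs ! k = - sinh (t k) \<cdot>\<^sub>v fs ! (m + r + k) \<and>
        A *\<^sub>v fs ! (m + r + k) = - cosh (t k) \<cdot>\<^sub>v fs ! (m + r + k) \<and>
        B *\<^sub>v fs ! (m + r + k) = - sinh (t k) \<cdot>\<^sub>v fs ! k"
    proof (cases "k < m")
      case True
      then have "cosh (t k) = d (I ! k)" "sinh (t k) = sqrt ((d (I ! k))\<^sup>2 - 1)"
        using nI(2)[OF True] by (auto simp: t_def cosh_arcosh_real sinh_arcosh_real)
      then show ?thesis
        using e1[OF True] e3[OF True] f1[OF True] f3[OF True] nI(2)[OF True]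
          B_eq_partner[OF ev[OF nI(1)[OF True]]] B_partner[OF ev[OF nI(1)[OF True]]] by (simp add: eig_def)
    next
      case False
      \<comment> \<open>The l-th eigenvector for 1 sits at m + l and the l-th one for -1 at m + r +
        (m + l), so these two are matched.\<close>
      with k obtain l where l: "k = m + l" "l < s"
        using le_Suc_ex[of m k] by auto
      have "fs ! k \<in> carrier_vec n" "fs ! (m + r + k) \<in> carrier_vec n"
        using e2[of l] e4[of l] l sr by (auto simp: eig_def)
      moreover from this have "0 \<cdot>\<^sub>v fs ! k = 0\<^sub>v n" "0 \<cdot>\<^sub>v fs ! (m + r + k) = 0\<^sub>v n" by auto
      ultimately show ?thesis
        using False l sr e2[of l] e4[of l] eig_1_B[OF e2, of l] eig_1_B[OF e4, of l]
        by (auto simp: t_def eig_def)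
    qed
    then show "A *\<^sub>v fs ! k = cosh (t k) \<cdot>\<^sub>v fs ! k" "B *\<^sub>v fs ! k = - sinh (t k) \<cdot>\<^sub>v fs ! (m + r + k)"
        "A *\<^sub>v fs ! (m + r + k) = - cosh (t k) \<cdot>\<^sub>v fs ! (m + r + k)"
        "B *\<^sub>v fs ! (m + r + k) = - sinh (t k) \<cdot>\<^sub>v fs ! k" by blast+
  next
    fix k assume "m + s \<le> k \<and> k < m + r"
    \<comment> \<open>These are the eigenvectors for 1 that remain unmatched.\<close>
    then obtain l where l: "k = m + l" "l < r"
      using le_Suc_ex[of m k] by auto
    then show "A *\<^sub>v fs ! k = fs ! k" "B *\<^sub>v fs ! k = 0\<^sub>v n"
      using e2[of l] eig_1_B[OF e2, of l] by (auto simp: eig_def)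
  qed
  ultimately show ?thesis using onl len n by (intro exI conjI impI)
qed

text \<open>The trace, computed in the orthonormal basis, is r - s. With the dimension 2m + r + s =
  p + q this forces m + r = p and m + s = q.\<close>

lemma ex_canonical_basis:
  assumes hyperbolic: "hyperbolic_pair n A B"
    and "n = p + q" "q \<le> p" "mat_trace A = real p - real q"
  obtains fs t where "orthonormal_list n fs" "length fs = n" "canonical_basis n A B p q ((!) fs) t"
proof -
  note A = hyperbolic_pairD(1)[OF hyperbolic]
  obtain fs m r s t where *: "orthonormal_list n fs" "length fs = n" "n = (m + r) + (m + s)"
    "s \<le> r \<longrightarrow> canonical_basis n A B (m + r) (m + s) ((!) fs) t"
    "(\<Sum>k<n. fs ! k \<bullet> (A *\<^sub>v fs ! k)) = real r - real s"
    using ex_canonical_basis_counts[OF hyperbolic] by (elim exE conjE) (rule that)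
  define U where "U = mat_of_cols n fs"
  have U: "U \<in> orthogonal_group n"
    unfolding U_def by (rule orthonormal_list_orthogonal_group[OF *(1,2)])
  note Uo = orthogonal_group_inverse[OF U]
  have "mat_trace A = mat_trace ((A * U) * U\<^sup>T)"
    using A Uo by (simp add: assoc_mult_mat[of _ n n _ n _ n])
  also have "\<dots> = mat_trace (U\<^sup>T * (A * U))"
    using A Uo by (intro mat_trace_mult_comm[of _ n n]) auto
  also have "\<dots> = (\<Sum>k<n. fs ! k \<bullet> (A *\<^sub>v fs ! k))"
    unfolding mat_trace_def
  proof (intro sum.cong)
    fix k assume "k \<in> {..<n}"
    then have k: "k < n" by simp
    then have "fs ! k \<in> carrier_vec n"
      using *(1,2) by (auto simp: orthonormal_list_def subset_iff)
    then have col: "col U k = fs ! k" using k *(2) by (simp add: U_def)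
    then have "col (A * U) k = A *\<^sub>v fs ! k" using k by (simp only: col_mult2[OF A Uo(1)])
    moreover have "(U\<^sup>T * (A * U)) $$ (k, k) = col U k \<bullet> col (A * U) k"
      using k A Uo(1) by (simp del: col_mult)
    ultimately show "(U\<^sup>T * (A * U)) $$ (k, k) = fs ! k \<bullet> (A *\<^sub>v fs ! k)"
      using col by simp
  qed (use Uo(1) in auto)
  finally have "real r - real s = real p - real q" using *(5) assms(4) by simp
  with *(3) assms(2,3) have "m + r = p" "m + s = q" "s \<le> r" by linarith+
  with *(4) have "canonical_basis n A B p q ((!) fs) t" by simp
  with *(1,2) show thesis by (rule that)
qed

section \<open>The middle factor and the signature matrix\<close>

text \<open>The matrix J of the overview. The entrywise form makes multiplication by it a change of
  sign of rows or columns.\<close>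

definition sgn_mat :: "nat \<Rightarrow> nat \<Rightarrow> 'a :: comm_ring_1 mat" where
  "sgn_mat p q = mat_diag (p + q) (\<lambda>i. if i < p then 1 else - 1)"

lemma sgn_mat_carrier [simp]: "sgn_mat p q \<in> carrier_mat (p + q) (p + q)"
  by (simp add: sgn_mat_def)

lemma sgn_mat_dim [simp]: "dim_row (sgn_mat p q) = p + q" "dim_col (sgn_mat p q) = p + q"
  using sgn_mat_carrier by blast+

lemma transpose_sgn_mat [simp]: "(sgn_mat p q)\<^sup>T = sgn_mat p q"
  by (intro eq_matI) (auto simp: sgn_mat_def mat_diag_def)

lemma sgn_mat_square: "sgn_mat p q * sgn_mat p q = (1\<^sub>m (p + q) :: 'a :: comm_ring_1 mat)"
  unfolding sgn_mat_def by (simp, intro eq_matI) (auto simp: mat_diag_def)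

lemma index_mult_sgn_mat:
  assumes "X \<in> carrier_mat m (p + q)" "i < m" "j < p + q"
  shows "(X * sgn_mat p q) $$ (i, j) = X $$ (i, j) * (if j < p then 1 else - 1)"
  unfolding sgn_mat_def mat_diag_mult_right[OF assms(1)] using assms by (simp add: mult.commute)

lemma index_sgn_mat_mult:
  assumes "X \<in> carrier_mat (p + q) m" "i < p + q" "j < m"
  shows "(sgn_mat p q * X) $$ (i, j) = (if i < p then 1 else - 1) * X $$ (i, j)"
  unfolding sgn_mat_def mat_diag_mult_left[OF assms(1)] using assms by simp

section \<open>The middle factor as a family of rotations by imaginary angles\<close>

lemma middle_factor_carrier [simp]:
  assumes "\<theta> \<in> carrier_vec q" "q \<le> p"
  shows "middle_factor p q \<theta> \<in> carrier_mat (p + q) (p + q)"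
  using assms by (auto simp: middle_factor_def nine_block_mat_def Ch_mat_def Sh_mat_def mat_diag_def
      intro!: carrier_matI)

lemma middle_factor_dim [simp]:
  assumes "\<theta> \<in> carrier_vec q" "q \<le> p"
  shows "dim_row (middle_factor p q \<theta>) = p + q" "dim_col (middle_factor p q \<theta>) = p + q"
  using middle_factor_carrier[OF assms] by blast+

text \<open>The cases follow the block sizes q, p - q, q; the last one names the offset k because
  coordinate p + k is coupled to coordinate k.\<close>

lemma index_cases:
  fixes p q j :: nat
  assumes "j < p + q" "q \<le> p"
  obtains "j < q" | "q \<le> j" "j < p" | k where "j = p + k" "k < q"
  using assms by (metis add_less_cancel_left le_Suc_ex not_less)

text \<open>Flattens the nested blocks: off the diagonal only the positions (k, p + k) and (p + k,
  k) with k < q can be nonzero.\<close>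

lemma index_middle_factor:
  assumes "\<theta> \<in> carrier_vec q" "q \<le> p" "i < p + q" "j < p + q"
  shows "middle_factor p q \<theta> $$ (i, j) =
    (if i = j then complex_of_real (if i < q then cosh (\<theta> $ i) else if i < p then 1 else cosh (\<theta> $ (i - p)))
     else if i < q \<and> j = p + i then \<i> * complex_of_real (sinh (\<theta> $ i))
     else if j < q \<and> i = p + j then - \<i> * complex_of_real (sinh (\<theta> $ j))
     else 0)"
  using assms(1,2)
  by (cases rule: index_cases[OF assms(3,2)]; cases rule: index_cases[OF assms(4,2)])
    (simp_all add: middle_factor_def nine_block_mat_def Ch_mat_def Sh_mat_def mat_diag_def, linarith)

lemma sum_two:
  fixes g :: "nat \<Rightarrow> 'a :: comm_monoid_add"
  assumes "a < n" "b < n" "a \<noteq> b" "\<And>k. k < n \<Longrightarrow> k \<noteq> a \<Longrightarrow> k \<noteq> b \<Longrightarrow> g k = 0"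
  shows "(\<Sum>k<n. g k) = g a + g b"
proof -
  have "(\<Sum>k<n. g k) = (\<Sum>k\<in>{a, b}. g k)"
    using assms by (intro sum.mono_neutral_right) auto
  then show ?thesis using assms by simp
qed

lemma sum_one:
  fixes g :: "nat \<Rightarrow> 'a :: comm_monoid_add"
  assumes "a < n" "\<And>k. k < n \<Longrightarrow> k \<noteq> a \<Longrightarrow> g k = 0"
  shows "(\<Sum>k<n. g k) = g a"
proof -
  have "(\<Sum>k<n. g k) = (\<Sum>k\<in>{a}. g k)"
    using assms by (intro sum.mono_neutral_right) auto
  then show ?thesis by simp
qed

text \<open>Each column of the middle factor has at most two nonzero entries, so columns k and p + k
  of \<open>X\<close> are mixed only with each other and the columns between q and p stay
  fixed.\<close>

lemma index_mult_middle_factor: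
  assumes \<theta>: "\<theta> \<in> carrier_vec q" "q \<le> p" and X: "X \<in> carrier_mat m (p + q)"
    and i: "i < m"
  shows "k < q \<Longrightarrow> (X * middle_factor p q \<theta>) $$ (i, k) =
      X $$ (i, k) * cosh (\<theta> $ k) - \<i> * (X $$ (i, p + k) * sinh (\<theta> $ k))"
    and "q \<le> k \<Longrightarrow> k < p \<Longrightarrow> (X * middle_factor p q \<theta>) $$ (i, k) = X $$ (i, k)"
    and "k < q \<Longrightarrow> (X * middle_factor p q \<theta>) $$ (i, p + k) =
      \<i> * (X $$ (i, k) * sinh (\<theta> $ k)) + X $$ (i, p + k) * cosh (\<theta> $ k)"
proof -
  have *: "(X * middle_factor p q \<theta>) $$ (i, j) = (\<Sum>l<p + q. X $$ (i, l) * middle_factor p q \<theta> $$ (l, j))"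
    if "j < p + q" for j
    using that X i middle_factor_carrier[OF \<theta>] by (simp add: scalar_prod_def lessThan_atLeast0)
  show "(X * middle_factor p q \<theta>) $$ (i, k) =
      X $$ (i, k) * cosh (\<theta> $ k) - \<i> * (X $$ (i, p + k) * sinh (\<theta> $ k))" if "k < q"
    using that \<theta>(2) by (subst *, simp, subst sum_two[of k _ "p + k"])
      (auto simp: index_middle_factor[OF \<theta>])
  show "(X * middle_factor p q \<theta>) $$ (i, k) = X $$ (i, k)" if "q \<le> k" "k < p"
    using that \<theta>(2) by (subst *, simp, subst sum_one[of k])
      (auto simp: index_middle_factor[OF \<theta>])
  show "(X * middle_factor p q \<theta>) $$ (i, p + k) =
      \<i> * (X $$ (i, k) * sinh (\<theta> $ k)) + X $$ (i, p + k) * cosh (\<theta> $ k)" if "k < q"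
    using that \<theta>(2) by (subst *, simp, subst sum_two[of k _ "p + k"])
      (auto simp: index_middle_factor[OF \<theta>])
qed

text \<open>On coordinates k and p + k the middle factor is the rotation by the imaginary angle i
  \<theta>_k, so the claim reduces to the addition formulas for cosh and sinh.\<close>

lemma middle_factor_add:
  assumes "\<theta> \<in> carrier_vec q" "\<phi> \<in> carrier_vec q" "q \<le> p"
  shows "middle_factor p q \<theta> * middle_factor p q \<phi> = middle_factor p q (\<theta> + \<phi>)"
proof (rule eq_matI)
  have s: "\<theta> + \<phi> \<in> carrier_vec q" using assms by simp
  note M = middle_factor_carrier[OF assms(1,3)] middle_factor_carrier[OF s assms(3)]
  fix i j assume "i < dim_row (middle_factor p q (\<theta> + \<phi>))" "j < dim_col (middle_factor p q (\<theta> + \<phi>))"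
  then have ij: "i < p + q" "j < p + q" using M(2) by auto
  note [simp] = index_mult_middle_factor[OF assms(2,3) M(1) ij(1)]
    index_middle_factor[OF assms(1,3)] index_middle_factor[OF s assms(3)]
  have [simp]: "\<i> * (\<i> * x * y) = - (x * y)" for x y :: complex
    by (simp add: mult.assoc[symmetric])
  show "(middle_factor p q \<theta> * middle_factor p q \<phi>) $$ (i, j) = middle_factor p q (\<theta> + \<phi>) $$ (i, j)"
    using assms ij by (cases rule: index_cases[OF ij(2) assms(3)])
      (auto simp: cosh_add sinh_add ring_distribs simp del: index_mult_mat(1))
qed (use assms in auto)

text \<open>cosh is even, sinh is odd, and the two coupled off-diagonal entries are
  opposite.\<close>

lemma middle_factor_uminus:
  assumes "\<theta> \<in> carrier_vec q" "q \<le> p"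
  shows "middle_factor p q (- \<theta>) = (middle_factor p q \<theta>)\<^sup>T"
proof (rule eq_matI)
  fix i j assume "i < dim_row (middle_factor p q \<theta>)\<^sup>T" "j < dim_col (middle_factor p q \<theta>)\<^sup>T"
  then have "i < p + q" "j < p + q" using middle_factor_carrier[OF assms] by auto
  then show "middle_factor p q (- \<theta>) $$ (i, j) = (middle_factor p q \<theta>)\<^sup>T $$ (i, j)"
    using assms middle_factor_carrier[OF assms] by (auto simp: index_middle_factor)
qed (use assms middle_factor_carrier[OF assms] middle_factor_carrier[of "- \<theta>" q p] in auto)

text \<open>By the two preceding rules M^T M = M(-\<theta>) M(\<theta>) = M(0) = I.\<close>

lemma middle_factor_orthogonal:
  assumes "\<theta> \<in> carrier_vec q" "q \<le> p"
  shows "middle_factor p q \<theta> \<in> orthogonal_group (p + q)"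
proof -
  have "- \<theta> + \<theta> = 0\<^sub>v q" using assms by simp
  moreover have "middle_factor p q (0\<^sub>v q) = 1\<^sub>m (p + q)"
    using assms(2) middle_factor_carrier[of "0\<^sub>v q" q p]
    by (intro eq_matI) (auto simp: index_middle_factor)
  ultimately show ?thesis
    using middle_factor_add[of "- \<theta>" q \<theta> p] assms middle_factor_carrier[OF assms]
    by (simp add: orthogonal_group_def middle_factor_uminus)
qed

text \<open>J reverses coordinate p + k but not k, hence it conjugates each of these rotations into
  its inverse.\<close>

lemma sgn_mat_middle_factor:
  assumes "\<theta> \<in> carrier_vec q" "q \<le> p"
  shows "sgn_mat p q * (middle_factor p q \<theta>)\<^sup>T = middle_factor p q \<theta> * sgn_mat p q"
proof (rule eq_matI)
  note M = middle_factor_carrier[OF assms]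
  fix i j assume "i < dim_row (middle_factor p q \<theta> * sgn_mat p q)"
    "j < dim_col (middle_factor p q \<theta> * sgn_mat p q)"
  then have ij: "i < p + q" "j < p + q" using M by auto
  show "(sgn_mat p q * (middle_factor p q \<theta>)\<^sup>T) $$ (i, j) = (middle_factor p q \<theta> * sgn_mat p q) $$ (i, j)"
    using ij assms M
    by (simp add: index_mult_sgn_mat[OF M ij] index_sgn_mat_mult[of "(middle_factor p q \<theta>)\<^sup>T" p q "p + q"]
        del: index_mult_mat(1))
      (auto simp: index_middle_factor)
qed (use middle_factor_carrier[OF assms] in auto)

text \<open>Moving J to the right turns M^T into a second M; this is where the doubled angle
  arises.\<close>

lemma middle_factor_conj_sgn:
  assumes "\<theta> \<in> carrier_vec q" "q \<le> p"
  shows "middle_factor p q \<theta> * sgn_mat p q * (middle_factor p q \<theta>)\<^sup>T =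
    middle_factor p q (\<theta> + \<theta>) * sgn_mat p q"
proof -
  note M = middle_factor_carrier[OF assms]
  have "middle_factor p q \<theta> * sgn_mat p q * (middle_factor p q \<theta>)\<^sup>T =
     middle_factor p q \<theta> * (middle_factor p q \<theta> * sgn_mat p q)"
    using M by (simp add: assoc_mult_mat[of _ "p + q" "p + q" _ "p + q" _ "p + q"]
        sgn_mat_middle_factor[OF assms])
  also have "\<dots> = middle_factor p q \<theta> * middle_factor p q \<theta> * sgn_mat p q"
    using M by (simp add: assoc_mult_mat[of _ "p + q" "p + q" _ "p + q" _ "p + q"])
  finally show ?thesis using middle_factor_add[OF assms(1) assms(1) assms(2)] by simp
qed

section \<open>Orthogonal matrices fixing the signature matrix\<close>

text \<open>For orthogonal \<open>W\<close> the invariance says that \<open>W\<close> commutes with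
  J. An entry linking the first p indices with the last q then equals its own negative, which is
  zero in characteristic zero.\<close>

lemma orthogonal_stabilizer_sgn_mat:
  fixes W :: "'a :: field_char_0 mat"
  assumes W: "W \<in> orthogonal_group (p + q)" and inv: "W * sgn_mat p q * W\<^sup>T = sgn_mat p q"
  obtains V\<^sub>p V\<^sub>q where "V\<^sub>p \<in> orthogonal_group p" "V\<^sub>q \<in> orthogonal_group q"
    "W = four_block_mat V\<^sub>p (0\<^sub>m p q) (0\<^sub>m q p) V\<^sub>q"
proof -
  let ?n = "p + q"
  note Wo = orthogonal_group_inverse[OF W]
  have "sgn_mat p q * W = W * sgn_mat p q * W\<^sup>T * W" by (simp only: inv)
  also have "\<dots> = W * sgn_mat p q * (W\<^sup>T * W)"
    by (rule assoc_mult_mat[of _ ?n ?n _ ?n _ ?n]) (use Wo(1) in auto)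
  also have "\<dots> = W * sgn_mat p q" using Wo(1,2) by simp
  finally have comm: "(if i < p then 1 else - 1) * W $$ (i, j) = W $$ (i, j) * (if j < p then 1 else - 1)"
    if "i < ?n" "j < ?n" for i j
    using index_mult_sgn_mat[OF Wo(1) that] index_sgn_mat_mult[OF Wo(1) that] by metis
  have W0: "W $$ (i, j) = 0" if "i < ?n" "j < ?n" "i < p \<longleftrightarrow> \<not> j < p" for i j
    using comm[OF that(1,2)] that(3) by (auto split: if_splits)
  define V\<^sub>p V\<^sub>q where "V\<^sub>p = mat p p (\<lambda>(i, j). W $$ (i, j))"
    and "V\<^sub>q = mat q q (\<lambda>(i, j). W $$ (p + i, p + j))"
  have V: "V\<^sub>p \<in> carrier_mat p p" "V\<^sub>q \<in> carrier_mat q q" by (auto simp: V\<^sub>p_def V\<^sub>q_def)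
  have eq: "W = four_block_mat V\<^sub>p (0\<^sub>m p q) (0\<^sub>m q p) V\<^sub>q"
    by (intro eq_matI) (use Wo(1) W0 in \<open>auto simp: V\<^sub>p_def V\<^sub>q_def\<close>)
  \<comment> \<open>Comparing the diagonal blocks of W^T W = I shows that each block is orthogonal
    by itself.\<close>
  have "four_block_mat (V\<^sub>p\<^sup>T * V\<^sub>p) (0\<^sub>m p q) (0\<^sub>m q p) (V\<^sub>q\<^sup>T * V\<^sub>q) = W\<^sup>T * W"
    unfolding eq using V
    by (simp add: transpose_four_block_mat[of _ p p _ q _ q] mult_four_block_mat[of _ p p _ q _ q _ _ p _ q])
  then have one: "four_block_mat (V\<^sub>p\<^sup>T * V\<^sub>p) (0\<^sub>m p q) (0\<^sub>m q p) (V\<^sub>q\<^sup>T * V\<^sub>q) = 1\<^sub>m ?n"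
    using Wo(2) by simp
  have "(V\<^sub>p\<^sup>T * V\<^sub>p) $$ (i, j) = 1\<^sub>m p $$ (i, j)" if "i < p" "j < p" for i j
    using arg_cong[OF one, of "\<lambda>X. X $$ (i, j)"] that V by (simp del: index_mult_mat(1))
  then have "V\<^sub>p\<^sup>T * V\<^sub>p = 1\<^sub>m p" using V by (intro eq_matI) auto
  moreover have "(V\<^sub>q\<^sup>T * V\<^sub>q) $$ (i, j) = 1\<^sub>m q $$ (i, j)" if "i < q" "j < q" for i j
    using arg_cong[OF one, of "\<lambda>X. X $$ (p + i, p + j)"] that V by (simp del: index_mult_mat(1))
  then have "V\<^sub>q\<^sup>T * V\<^sub>q = 1\<^sub>m q" using V by (intro eq_matI) auto
  ultimately show thesis using that[of V\<^sub>p V\<^sub>q] V eq by (auto simp: orthogonal_group_def)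
qed

text \<open>J is plus or minus the identity on each block, so only V_p V_p^T and - V_q V_q^T
  remain.\<close>

lemma block_diag_fixes_sgn_mat:
  fixes V\<^sub>p :: "'a :: field mat"
  assumes "V\<^sub>p \<in> orthogonal_group p" "V\<^sub>q \<in> orthogonal_group q"
  defines "V \<equiv> four_block_mat V\<^sub>p (0\<^sub>m p q) (0\<^sub>m q p) V\<^sub>q"
  shows "V * sgn_mat p q * V\<^sup>T = sgn_mat p q"
proof -
  note V = orthogonal_group_inverse[OF assms(1)] orthogonal_group_inverse[OF assms(2)]
  have J: "(sgn_mat p q :: 'a mat) = four_block_mat (1\<^sub>m p) (0\<^sub>m p q) (0\<^sub>m q p) (- 1\<^sub>m q)"
    by (intro eq_matI) (auto simp: sgn_mat_def mat_diag_def)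
  have Z: "- 0\<^sub>m p q = (0\<^sub>m p q :: 'a mat)" "- 0\<^sub>m q p = (0\<^sub>m q p :: 'a mat)"
    by (auto intro!: eq_matI)
  show ?thesis
    unfolding V_def J using V Z
    by (simp add: transpose_four_block_mat[of _ p p _ q _ q] mult_four_block_mat[of _ p p _ q _ q _ _ p _ q])
qed

section \<open>Existence\<close>

lemma map_mat_of_real_orthogonal:
  assumes "U \<in> orthogonal_group n"
  shows "map_mat complex_of_real U \<in> orthogonal_group n"
proof -
  note Uo = orthogonal_group_inverse[OF assms]
  have "(map_mat complex_of_real U)\<^sup>T * map_mat complex_of_real U = map_mat complex_of_real (U\<^sup>T * U)"
    using Uo(1) by (intro eq_matI) (auto simp: scalar_prod_def)
  also have "\<dots> = 1\<^sub>m n" unfolding Uo(2) by (intro eq_matI) auto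
  finally show ?thesis using Uo(1) by (simp add: orthogonal_group_def)
qed

lemma Re_conj_of_real:
  assumes "U \<in> carrier_mat n n" "X \<in> carrier_mat n n"
  shows "map_mat Re (map_mat complex_of_real U * X * (map_mat complex_of_real U)\<^sup>T) =
    U * map_mat Re X * U\<^sup>T"
proof -
  have "map_mat Re (map_mat complex_of_real U * X * (map_mat complex_of_real U)\<^sup>T) =
    map_mat Re (map_mat complex_of_real U * X) * U\<^sup>T"
    using assms by (intro eq_matI) (auto simp: scalar_prod_def simp del: assoc_mult_mat)
  also have "map_mat Re (map_mat complex_of_real U * X) = U * map_mat Re X"
    using assms by (intro eq_matI) (auto simp: scalar_prod_def simp del: assoc_mult_mat)
  finally show ?thesis .
qed

text \<open>With S = A + i B, the real part of S S = I is A A - B B = I and the imaginary part is A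
  B + B A = 0.\<close>

lemma hyperbolic_pair_Re_Im:
  assumes S: "S \<in> carrier_mat n n" and sym: "S\<^sup>T = S" and inv: "S * S = 1\<^sub>m n"
  shows "hyperbolic_pair n (map_mat Re S) (map_mat Im S)"
proof -
  have sq: "(\<Sum>k = 0..<n. S $$ (i, k) * S $$ (k, j)) = of_bool (i = j)" if "i < n" "j < n" for i j
    using arg_cong[OF inv, of "\<lambda>X. X $$ (i, j)"] that S by (simp add: scalar_prod_def)
  have 1: "map_mat Re S * map_mat Re S = 1\<^sub>m n + map_mat Im S * map_mat Im S"
  proof (rule eq_matI)
    fix i j assume "i < dim_row (1\<^sub>m n + map_mat Im S * map_mat Im S)"
      "j < dim_col (1\<^sub>m n + map_mat Im S * map_mat Im S)"
    then have ij: "i < n" "j < n" using S by auto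
    from arg_cong[OF sq[OF this], of Re]
    show "(map_mat Re S * map_mat Re S) $$ (i, j) = (1\<^sub>m n + map_mat Im S * map_mat Im S) $$ (i, j)"
      using ij S by (simp add: scalar_prod_def sum_subtractf algebra_simps split: if_splits)
  qed (use S in auto)
  have 2: "map_mat Re S * map_mat Im S = - (map_mat Im S * map_mat Re S)"
  proof (rule eq_matI)
    fix i j assume "i < dim_row (- (map_mat Im S * map_mat Re S))"
      "j < dim_col (- (map_mat Im S * map_mat Re S))"
    then have ij: "i < n" "j < n" using S by auto
    from arg_cong[OF sq[OF this], of Im]
    show "(map_mat Re S * map_mat Im S) $$ (i, j) = (- (map_mat Im S * map_mat Re S)) $$ (i, j)"
      using ij S by (simp add: scalar_prod_def sum.distrib of_bool_def split: if_splits)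
  qed (use S in auto)
  have "S $$ (i, j) = S $$ (j, i)" if "i < n" "j < n" for i j
    using arg_cong[OF sym, of "\<lambda>X. X $$ (i, j)"] that S by simp
  then have "(map_mat Re S)\<^sup>T = map_mat Re S" "(map_mat Im S)\<^sup>T = map_mat Im S"
    using S by (auto intro!: eq_matI)
  with S 1 2 show ?thesis by (simp add: hyperbolic_pair_def)
qed

text \<open>The inner Q^T Q cancels in S S, leaving Q J J Q^T = I. Cyclicity reduces the trace of S
  to that of J.\<close>

lemma orthogonal_conj_sgn_mat:
  fixes Q :: "'a :: field mat"
  assumes "Q \<in> orthogonal_group (p + q)"
  defines "S \<equiv> Q * sgn_mat p q * Q\<^sup>T"
  shows "S \<in> carrier_mat (p + q) (p + q)" "S\<^sup>T = S" "S * S = 1\<^sub>m (p + q)"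
    "mat_trace S = of_nat p - of_nat q"
proof -
  let ?n = "p + q" and ?J = "sgn_mat p q :: 'a mat"
  note Qo = orthogonal_group_inverse[OF assms(1)]
  note assoc = assoc_mult_mat[of _ ?n ?n _ ?n _ ?n]
  have QJ: "Q * ?J \<in> carrier_mat ?n ?n" and JQ: "?J * Q\<^sup>T \<in> carrier_mat ?n ?n" using Qo(1) by auto
  show "S \<in> carrier_mat ?n ?n"
    unfolding S_def by (rule mult_carrier_mat[OF QJ]) (use Qo(1) in simp)
  have S': "S = Q * (?J * Q\<^sup>T)" unfolding S_def by (rule assoc) (use Qo(1) in auto)
  have "S\<^sup>T = Q\<^sup>T\<^sup>T * (Q * ?J)\<^sup>T"
    unfolding S_def by (rule transpose_mult[of _ ?n ?n _ ?n]) (use Qo(1) QJ in auto)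
  also have "(Q * ?J)\<^sup>T = ?J\<^sup>T * Q\<^sup>T"
    by (rule transpose_mult[of _ ?n ?n _ ?n]) (use Qo(1) in auto)
  finally show "S\<^sup>T = S" by (simp add: S')
  have "S * S = Q * ?J * Q\<^sup>T * (Q * (?J * Q\<^sup>T))"
    by (subst (2) S') (simp only: S_def)
  also have "\<dots> = Q * ?J * (Q\<^sup>T * (Q * (?J * Q\<^sup>T)))"
    by (rule assoc) (use QJ JQ Qo(1) in auto)
  also have "Q\<^sup>T * (Q * (?J * Q\<^sup>T)) = (Q\<^sup>T * Q) * (?J * Q\<^sup>T)"
    by (rule assoc[symmetric]) (use Qo(1) JQ in auto)
  also have "\<dots> = ?J * Q\<^sup>T" using JQ by (simp add: Qo(2))
  also have "Q * ?J * (?J * Q\<^sup>T) = Q * (?J * (?J * Q\<^sup>T))"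
    by (rule assoc) (use Qo(1) JQ in auto)
  also have "?J * (?J * Q\<^sup>T) = (?J * ?J) * Q\<^sup>T"
    by (rule assoc[symmetric]) (use Qo(1) in auto)
  also have "\<dots> = Q\<^sup>T" using Qo(1) by (simp add: sgn_mat_square)
  finally show "S * S = 1\<^sub>m ?n" using Qo(3) by simp
  have "mat_trace S = mat_trace (Q\<^sup>T * (Q * ?J))"
    unfolding S_def by (rule mat_trace_mult_comm[of _ ?n ?n]) (use Qo(1) in auto)
  also have "Q\<^sup>T * (Q * ?J) = (Q\<^sup>T * Q) * ?J"
    by (rule assoc[symmetric]) (use Qo(1) in auto)
  also have "\<dots> = ?J" by (simp add: Qo(2))
  also have "mat_trace ?J = (\<Sum>i<p + q. if i < p then 1 else - 1)"
    by (auto simp: mat_trace_def sgn_mat_def mat_diag_def intro!: sum.cong)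
  also have "\<dots> = of_nat p - of_nat q"
    by (induction q) auto
  finally show "mat_trace S = of_nat p - of_nat q" .
qed

text \<open>Column j on the left is A f_j + i B f_j; the relations of the canonical basis are
  exactly the columns of U M(\<tau>) J.\<close>

lemma canonical_basis_conj:
  assumes S: "S \<in> carrier_mat (p + q) (p + q)" and "q \<le> p" and t: "\<tau> \<in> carrier_vec q"
    and hyp: "hyperbolic_pair (p + q) (map_mat Re S) (map_mat Im S)"
    and fs: "orthonormal_list (p + q) fs" "length fs = p + q"
    and can: "canonical_basis (p + q) (map_mat Re S) (map_mat Im S) p q ((!) fs) (\<lambda>k. \<tau> $ k)"
  defines "U \<equiv> map_mat complex_of_real (mat_of_cols (p + q) fs)"
  shows "S * U = U * middle_factor p q \<tau> * sgn_mat p q"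
proof (rule eq_matI)
  let ?n = "p + q"
  have U: "U \<in> carrier_mat ?n ?n" using mat_of_cols_carrier(1)[of ?n fs] fs(2) by (simp add: U_def)
  note M = middle_factor_carrier[OF t \<open>q \<le> p\<close>]
  fix i j
  assume "i < dim_row (U * middle_factor p q \<tau> * sgn_mat p q)"
    "j < dim_col (U * middle_factor p q \<tau> * sgn_mat p q)"
  then have ij: "i < ?n" "j < ?n" using U by auto
  have fdim: "dim_vec (fs ! j) = ?n" if "j < ?n" for j
    using fs that by (auto simp: orthonormal_list_def subset_iff)
  have Ui: "U $$ (i, j) = complex_of_real (fs ! j $ i)" if "j < ?n" for j
    using ij that fs(2) by (simp add: U_def mat_of_cols_index)
  \<comment> \<open>The columns of \<open>U\<close> are real, so the real and imaginary parts of
    \<open>S\<close> act on them separately.\<close>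
  have SU: "(S * U) $$ (i, j) =
      Complex ((map_mat Re S *\<^sub>v fs ! j) $ i) ((map_mat Im S *\<^sub>v fs ! j) $ i)" if "j < ?n" for j
    using ij that U S fs(2) fdim[OF that]
    by (auto simp: complex_eq_iff scalar_prod_def U_def mat_of_cols_index)
  have cols: "(U * middle_factor p q \<tau> * sgn_mat p q) $$ (i, j) =
      (U * middle_factor p q \<tau>) $$ (i, j) * (if j < p then 1 else - 1)"
    by (rule index_mult_sgn_mat) (use U M ij in auto)
  note UM = index_mult_middle_factor[OF t \<open>q \<le> p\<close> U ij(1)]
  have can1: "map_mat Re S *\<^sub>v fs ! k = cosh (\<tau> $ k) \<cdot>\<^sub>v fs ! k"
      "map_mat Im S *\<^sub>v fs ! k = - sinh (\<tau> $ k) \<cdot>\<^sub>v fs ! (p + k)"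
      "map_mat Re S *\<^sub>v fs ! (p + k) = - cosh (\<tau> $ k) \<cdot>\<^sub>v fs ! (p + k)"
      "map_mat Im S *\<^sub>v fs ! (p + k) = - sinh (\<tau> $ k) \<cdot>\<^sub>v fs ! k" if "k < q" for k
    using can that unfolding canonical_basis_def by auto
  have can2: "map_mat Re S *\<^sub>v fs ! k = fs ! k" "map_mat Im S *\<^sub>v fs ! k = 0\<^sub>v ?n"
    if "q \<le> k" "k < p" for k
    using can that unfolding canonical_basis_def by auto
  show "(S * U) $$ (i, j) = (U * middle_factor p q \<tau> * sgn_mat p q) $$ (i, j)"
    unfolding cols SU[OF ij(2)]
  proof (cases rule: index_cases[OF ij(2) \<open>q \<le> p\<close>])
    case 1
    then show "Complex ((map_mat Re S *\<^sub>v fs ! j) $ i) ((map_mat Im S *\<^sub>v fs ! j) $ i) =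
      (U * middle_factor p q \<tau>) $$ (i, j) * (if j < p then 1 else - 1)"
      using ij \<open>q \<le> p\<close> unfolding can1[OF 1] UM(1)[OF 1]
      by (simp add: Ui fdim complex_eq_iff)
  next
    case 2
    then show "Complex ((map_mat Re S *\<^sub>v fs ! j) $ i) ((map_mat Im S *\<^sub>v fs ! j) $ i) =
      (U * middle_factor p q \<tau>) $$ (i, j) * (if j < p then 1 else - 1)"
      using ij unfolding can2[OF 2] UM(2)[OF 2]
      by (simp add: Ui fdim complex_eq_iff)
  next
    case (3 k)
    then show "Complex ((map_mat Re S *\<^sub>v fs ! j) $ i) ((map_mat Im S *\<^sub>v fs ! j) $ i) =
      (U * middle_factor p q \<tau>) $$ (i, j) * (if j < p then 1 else - 1)"
      using ij \<open>q \<le> p\<close> unfolding 3(1) can1[OF 3(2)] UM(3)[OF 3(2)]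
      by (simp add: Ui fdim complex_eq_iff)
  qed
qed (use S fs(2) in \<open>auto simp: U_def\<close>)

lemma ex_factorization:
  assumes "q \<le> p" and Q: "Q \<in> orthogonal_group (p + q)"
  shows "\<exists>\<theta> U V\<^sub>p V\<^sub>q. is_factorization p q Q U V\<^sub>p V\<^sub>q \<theta>"
proof -
  let ?n = "p + q" and ?J = "sgn_mat p q :: complex mat"
  note assoc = assoc_mult_mat[of _ ?n ?n _ ?n _ ?n]
  define S where "S = Q * ?J * Q\<^sup>T"
  note S = orthogonal_conj_sgn_mat[OF Q, folded S_def]
  have hyp: "hyperbolic_pair ?n (map_mat Re S) (map_mat Im S)"
    by (rule hyperbolic_pair_Re_Im[OF S(1-3)])
  have "mat_trace (map_mat Re S) = Re (mat_trace S)"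
    using S(1) by (simp add: mat_trace_def)
  then have "mat_trace (map_mat Re S) = real p - real q" by (simp add: S(4))
  then obtain fs t where fs: "orthonormal_list ?n fs" "length fs = ?n"
    "canonical_basis ?n (map_mat Re S) (map_mat Im S) p q ((!) fs) t"
    by (rule ex_canonical_basis[OF hyp refl \<open>q \<le> p\<close>])
  \<comment> \<open>M J M^T carries twice the angle of M, so \<open>\<theta>\<close> is half of what
    the canonical basis supplies.\<close>
  define \<tau> \<theta> where "\<tau> = vec q t" and "\<theta> = vec q (\<lambda>k. t k / 2)"
  have \<tau>: "\<tau> \<in> carrier_vec q" and \<theta>: "\<theta> \<in> carrier_vec q" by (auto simp: \<tau>_def \<theta>_def)
  have \<theta>2: "\<theta> + \<theta> = \<tau>" by (auto simp: \<tau>_def \<theta>_def)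
  have can: "canonical_basis ?n (map_mat Re S) (map_mat Im S) p q ((!) fs) (\<lambda>k. \<tau> $ k)"
    using fs(3) by (simp add: canonical_basis_def \<tau>_def)
  define R where "R = mat_of_cols ?n fs"
  define U where "U = map_mat complex_of_real R"
  define M where "M = middle_factor p q \<theta>"
  have R: "R \<in> orthogonal_group ?n"
    unfolding R_def by (rule orthonormal_list_orthogonal_group[OF fs(1,2)])
  have U: "U \<in> orthogonal_group ?n" unfolding U_def by (rule map_mat_of_real_orthogonal[OF R])
  have M: "M \<in> orthogonal_group ?n" unfolding M_def by (rule middle_factor_orthogonal[OF \<theta> \<open>q \<le> p\<close>])
  note Qo = orthogonal_group_inverse[OF Q] and Uo = orthogonal_group_inverse[OF U]
    and Mo = orthogonal_group_inverse[OF M]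
  have SU: "S * U = U * (M * ?J * M\<^sup>T)"
    using canonical_basis_conj[OF S(1) \<open>q \<le> p\<close> \<tau> hyp fs(1,2) can]
      middle_factor_conj_sgn[OF \<theta> \<open>q \<le> p\<close>] middle_factor_carrier[OF \<tau> \<open>q \<le> p\<close>] Uo(1)
    by (simp add: \<theta>2 U_def R_def M_def assoc[OF _ _ sgn_mat_carrier])
  define G where "G = U * M"
  have G: "G \<in> orthogonal_group ?n" unfolding G_def by (rule orthogonal_group_mult[OF U M])
  note Go = orthogonal_group_inverse[OF G]
  \<comment> \<open>\<open>G\<close> and \<open>Q\<close> both conjugate J into \<open>S\<close>,
    hence the quotient \<open>W\<close> fixes J and must be block diagonal.\<close>
  define W where "W = G\<^sup>T * Q"
  have W: "W \<in> orthogonal_group ?n"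
    unfolding W_def by (rule orthogonal_group_mult[OF orthogonal_group_transpose[OF G] Q])
  have MJ: "M * ?J \<in> carrier_mat ?n ?n" "M * ?J * M\<^sup>T \<in> carrier_mat ?n ?n" using Mo(1) by auto
  have SG: "S * G = G * ?J"
  proof -
    have "S * G = S * U * M" unfolding G_def by (rule assoc[symmetric]) (use S(1) Uo(1) Mo(1) in auto)
    also have "\<dots> = U * (M * ?J * M\<^sup>T * M)" unfolding SU by (rule assoc) (use Uo(1) Mo(1) MJ in auto)
    also have "M * ?J * M\<^sup>T * M = M * ?J * (M\<^sup>T * M)" by (rule assoc) (use Mo(1) MJ in auto)
    also have "\<dots> = M * ?J" using MJ Mo(2) by simp
    also have "U * (M * ?J) = G * ?J" unfolding G_def by (rule assoc[symmetric]) (use Uo(1) Mo(1) in auto)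
    finally show ?thesis .
  qed
  have "W * ?J * W\<^sup>T = G\<^sup>T * (S * G)"
  proof -
    have "W\<^sup>T = Q\<^sup>T * G" using Qo(1) Go(1) by (simp add: W_def transpose_mult[of _ ?n ?n _ ?n])
    moreover have "W * ?J = G\<^sup>T * (Q * ?J)"
      unfolding W_def by (rule assoc) (use Qo(1) Go(1) in auto)
    ultimately have "W * ?J * W\<^sup>T = G\<^sup>T * (Q * ?J) * (Q\<^sup>T * G)" by simp
    also have "\<dots> = G\<^sup>T * ((Q * ?J) * (Q\<^sup>T * G))"
      by (rule assoc) (use Qo(1) Go(1) in auto)
    also have "(Q * ?J) * (Q\<^sup>T * G) = S * G"
      unfolding S_def by (rule assoc[symmetric]) (use Qo(1) Go(1) in auto)
    finally show ?thesis .
  qed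
  also have "\<dots> = G\<^sup>T * G * ?J"
    unfolding SG by (rule assoc[symmetric]) (use Go(1) in auto)
  finally have "W * ?J * W\<^sup>T = ?J" using Go(2) by simp
  then obtain V\<^sub>p V\<^sub>q where V: "V\<^sub>p \<in> orthogonal_group p" "V\<^sub>q \<in> orthogonal_group q"
    "W = four_block_mat V\<^sub>p (0\<^sub>m p q) (0\<^sub>m q p) V\<^sub>q"
    using orthogonal_stabilizer_sgn_mat[OF W] by blast
  have "G * W = G * G\<^sup>T * Q"
    unfolding W_def by (rule assoc[symmetric]) (use Go(1) Qo(1) in auto)
  then have "Q = G * W" using Go(3) Qo(1) by simp
  then have "is_factorization p q Q R V\<^sub>p V\<^sub>q \<theta>"
    using R V \<theta> by (simp add: is_factorization_def G_def M_def U_def)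
  then show ?thesis by blast
qed

section \<open>Uniqueness\<close>

text \<open>The eigenvalues of \<open>Re (Q J Q\<^sup>T)\<close>.\<close>

definition real_spectrum :: "nat \<Rightarrow> nat \<Rightarrow> real vec \<Rightarrow> nat \<Rightarrow> real" where
  "real_spectrum p q \<theta> i =
    (if i < q then cosh (2 * \<theta> $ i) else if i < p then 1 else - cosh (2 * \<theta> $ (i - p)))"

text \<open>The block diagonal factor fixes J and drops out, leaving U M(2 \<theta>) J U^T. Its real
  part stays between the real factors and loses the imaginary off-diagonal entries, so it is
  diagonal.\<close>

lemma factorization_Re_conj_sgn:
  assumes "q \<le> p" and fac: "is_factorization p q Q U V\<^sub>p V\<^sub>q \<theta>"
  shows "map_mat Re (Q * sgn_mat p q * Q\<^sup>T) = U * mat_diag (p + q) (real_spectrum p q \<theta>) * U\<^sup>T"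
proof -
  let ?n = "p + q" and ?J = "sgn_mat p q :: complex mat"
  note assoc = assoc_mult_mat[of _ ?n ?n _ ?n _ ?n]
  define V where "V = four_block_mat V\<^sub>p (0\<^sub>m p q) (0\<^sub>m q p) V\<^sub>q"
  define M where "M = middle_factor p q \<theta>"
  define C where "C = map_mat complex_of_real U"
  have U: "U \<in> orthogonal_group ?n" and \<theta>: "\<theta> \<in> carrier_vec q" and Q: "Q = C * M * V"
    and Vs: "V\<^sub>p \<in> orthogonal_group p" "V\<^sub>q \<in> orthogonal_group q"
    using fac by (auto simp: is_factorization_def V_def M_def C_def)
  have c: "U \<in> carrier_mat ?n ?n" "C \<in> carrier_mat ?n ?n" "M \<in> carrier_mat ?n ?n" "V \<in> carrier_mat ?n ?n"
    using orthogonal_group_inverse(1)[OF U] orthogonal_group_inverse(1)[OF Vs(1)]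
      orthogonal_group_inverse(1)[OF Vs(2)] middle_factor_carrier[OF \<theta> \<open>q \<le> p\<close>]
    by (auto simp: C_def M_def V_def)
  define G where "G = C * M"
  have G: "G \<in> carrier_mat ?n ?n" using c by (simp add: G_def)
  have VJV: "V * ?J * V\<^sup>T = ?J" unfolding V_def by (rule block_diag_fixes_sgn_mat[OF Vs])
  have "Q * ?J * Q\<^sup>T = G * V * ?J * (V\<^sup>T * G\<^sup>T)"
    using G c by (simp add: Q G_def[symmetric] transpose_mult[of _ ?n ?n _ ?n])
  also have "G * V * ?J = G * (V * ?J)" by (rule assoc) (use G c in auto)
  also have "\<dots> * (V\<^sup>T * G\<^sup>T) = G * ((V * ?J) * (V\<^sup>T * G\<^sup>T))"
    by (rule assoc) (use G c in auto)
  also have "(V * ?J) * (V\<^sup>T * G\<^sup>T) = V * ?J * V\<^sup>T * G\<^sup>T"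
    by (rule assoc[symmetric]) (use G c in auto)
  also have "\<dots> = ?J * (M\<^sup>T * C\<^sup>T)"
    unfolding VJV using c by (simp add: G_def transpose_mult[of _ ?n ?n _ ?n])
  also have "\<dots> = ?J * M\<^sup>T * C\<^sup>T" by (rule assoc[symmetric]) (use c in auto)
  also have "G * (?J * M\<^sup>T * C\<^sup>T) = G * (?J * M\<^sup>T) * C\<^sup>T"
    by (rule assoc[symmetric]) (use G c in auto)
  also have "G * (?J * M\<^sup>T) = C * (M * (?J * M\<^sup>T))"
    unfolding G_def by (rule assoc) (use c in auto)
  also have "M * (?J * M\<^sup>T) = M * ?J * M\<^sup>T" by (rule assoc[symmetric]) (use c in auto)
  also have "\<dots> = middle_factor p q (\<theta> + \<theta>) * ?J"
    unfolding M_def by (rule middle_factor_conj_sgn[OF \<theta> \<open>q \<le> p\<close>])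
  finally have *: "Q * ?J * Q\<^sup>T = C * (middle_factor p q (\<theta> + \<theta>) * ?J) * C\<^sup>T" .
  have t: "\<theta> + \<theta> \<in> carrier_vec q" using \<theta> by simp
  note M2 = middle_factor_carrier[OF t \<open>q \<le> p\<close>]
  have "map_mat Re (middle_factor p q (\<theta> + \<theta>) * ?J) = mat_diag ?n (real_spectrum p q \<theta>)"
  proof (rule eq_matI)
    fix i j assume "i < dim_row (mat_diag ?n (real_spectrum p q \<theta>))"
      "j < dim_col (mat_diag ?n (real_spectrum p q \<theta>))"
    then have ij: "i < ?n" "j < ?n" by (auto simp: mat_diag_def)
    then have "map_mat Re (middle_factor p q (\<theta> + \<theta>) * ?J) $$ (i, j) =
        Re ((middle_factor p q (\<theta> + \<theta>) * ?J) $$ (i, j))" using M2 by simp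
    then show "map_mat Re (middle_factor p q (\<theta> + \<theta>) * ?J) $$ (i, j) =
        mat_diag ?n (real_spectrum p q \<theta>) $$ (i, j)"
      unfolding index_mult_sgn_mat[OF M2 ij]
      using ij \<theta> \<open>q \<le> p\<close>
      by (auto simp: index_middle_factor[OF t \<open>q \<le> p\<close>] real_spectrum_def mat_diag_def
          simp del: index_mult_mat)
  qed (use M2 in \<open>auto simp: mat_diag_def\<close>)
  moreover have "middle_factor p q (\<theta> + \<theta>) * ?J \<in> carrier_mat ?n ?n" using M2 by simp
  ultimately show ?thesis
    unfolding * C_def by (subst Re_conj_of_real[OF c(1)]) simp_all
qed

lemma proots_prod_list_linear_factors:
  fixes as :: "'a :: idom list"
  shows "proots (\<Prod>a\<leftarrow>as. [:- a, 1:]) = mset as"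
proof (induction as)
  case (Cons a as)
  have "(\<Prod>a\<leftarrow>as. [:- a, 1:]) \<noteq> 0" by (subst prod_list_zero_iff) auto
  then show ?case using Cons by (simp add: proots_mult del: mult_pCons_left)
qed simp

text \<open>Both diagonal matrices are similar to the same matrix; the roots of the common
  characteristic polynomial, with multiplicity, are the diagonal entries.\<close>

lemma orthogonal_conj_mat_diag_mset:
  fixes U U' :: "'a :: field mat"
  assumes "U \<in> orthogonal_group n" "U' \<in> orthogonal_group n"
    and "U * mat_diag n d * U\<^sup>T = U' * mat_diag n d' * U'\<^sup>T"
  shows "mset (map d [0..<n]) = mset (map d' [0..<n])"
proof -
  have *: "proots (char_poly (U * mat_diag n d * U\<^sup>T)) = mset (map d [0..<n])"
    if "U \<in> orthogonal_group n" for U :: "'a mat" and d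
  proof -
    note Uo = orthogonal_group_inverse[OF that]
    have "similar_mat (U * mat_diag n d * U\<^sup>T) (mat_diag n d)"
      using Uo by (intro similar_matI[of _ _ U "U\<^sup>T" n]) auto
    then have "char_poly (U * mat_diag n d * U\<^sup>T) = char_poly (mat_diag n d)"
      by (rule char_poly_similar)
    also have "\<dots> = (\<Prod>a\<leftarrow>diag_mat (mat_diag n d). [:- a, 1:])"
      by (rule char_poly_upper_triangular[of _ n]) (auto simp: mat_diag_def)
    also have "diag_mat (mat_diag n d) = map d [0..<n]"
      by (auto simp: diag_mat_def mat_diag_def)
    finally show ?thesis by (simp only: proots_prod_list_linear_factors)
  qed
  show ?thesis using *[OF assms(1), of d] *[OF assms(2), of d'] assms(3) by simp
qed

text \<open>Keeping the positive values discards every -cosh(2 \<theta>_k); cancelling the p - q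
  ones then leaves the multiset of the cosh(2 \<theta>_k).\<close>

lemma real_spectrum_eq_up_to_order_and_signs:
  assumes "q \<le> p"
    and eq: "mset (map (real_spectrum p q \<theta>) [0..<p + q]) = mset (map (real_spectrum p q \<theta>') [0..<p + q])"
  shows "eq_up_to_order_and_signs q \<theta> \<theta>'"
proof -
  let ?c = "\<lambda>\<theta>. map (\<lambda>k. cosh (2 * \<theta> $ k)) [0..<q]"
  have pos: "filter_mset (\<lambda>x. x > 0) (mset (map (real_spectrum p q \<theta>) [0..<p + q])) =
      mset (?c \<theta>) + replicate_mset (p - q) 1" for \<theta>
  proof -
    have "[0..<p + q] = [0..<q] @ [q..<p] @ [p..<p + q]"
      using \<open>q \<le> p\<close> upt_add_eq_append[of 0 q "p - q"] upt_add_eq_append[of 0 p q] by simp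
    moreover have "map (real_spectrum p q \<theta>) [0..<q] = ?c \<theta>"
      by (simp add: real_spectrum_def)
    moreover have "map (real_spectrum p q \<theta>) [q..<p] = replicate (p - q) 1"
      by (intro nth_equalityI) (auto simp: real_spectrum_def)
    moreover have "map (real_spectrum p q \<theta>) [p..<p + q] = map uminus (?c \<theta>)"
      using \<open>q \<le> p\<close> by (intro nth_equalityI) (auto simp: real_spectrum_def)
    moreover have "filter (\<lambda>x. x > 0) (?c \<theta>) = ?c \<theta>" "filter (\<lambda>x. x > 0) (map uminus (?c \<theta>)) = []"
      by (auto simp: filter_empty_conv not_less intro!: filter_True)
    moreover have "filter (\<lambda>x. x > 0) (replicate (p - q) (1 :: real)) = replicate (p - q) 1"
      by (auto intro!: filter_True)
    ultimately have "filter (\<lambda>x. x > 0) (map (real_spectrum p q \<theta>) [0..<p + q]) =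
        ?c \<theta> @ replicate (p - q) 1"
      by (simp only: map_append filter_append append_Nil2)
    then have "mset (filter (\<lambda>x. x > 0) (map (real_spectrum p q \<theta>) [0..<p + q])) =
        mset (?c \<theta> @ replicate (p - q) 1)" by (rule arg_cong)
    then show ?thesis by (simp only: mset_filter mset_append mset_replicate)
  qed
  have "mset (?c \<theta>') = mset (?c \<theta>)"
    using pos[of \<theta>] pos[of \<theta>'] eq by (metis add_right_cancel)
  \<comment> \<open>Equal multisets supply the reordering; the signs remain free because cosh
    determines only the absolute value of its real argument.\<close>
  then obtain \<pi> where \<pi>: "\<pi> permutes {..<length (?c \<theta>)}" "permute_list \<pi> (?c \<theta>) = ?c \<theta>'"
    by (rule mset_eq_permutation)
  have perm: "\<pi> permutes {..<q}" using \<pi>(1) by simp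
  show ?thesis
    unfolding eq_up_to_order_and_signs_def
  proof (intro exI[of _ \<pi>] conjI allI impI perm)
    fix k assume k: "k < q"
    then have \<pi>k: "\<pi> k < q" using permutes_in_image[OF perm, of k] by simp
    have "cosh (2 * \<theta>' $ k) = ?c \<theta>' ! k" using k by simp
    also have "\<dots> = ?c \<theta> ! \<pi> k"
      unfolding \<pi>(2)[symmetric] using k \<pi>(1) by (subst permute_list_nth) auto
    also have "\<dots> = cosh (2 * \<theta> $ \<pi> k)" using \<pi>k by simp
    finally show "\<theta>' $ k = \<theta> $ \<pi> k \<or> \<theta>' $ k = - \<theta> $ \<pi> k" by (auto simp: abs_if split: if_splits)
  qed
qed

theorem theorem8p4:
  fixes n p q :: nat and Q :: "complex mat"
  assumes "n = p + q" and "p \<ge> q" and "Q \<in> orthogonal_group n"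
  shows "\<exists>\<theta>. (\<exists>U V\<^sub>p V\<^sub>q. is_factorization p q Q U V\<^sub>p V\<^sub>q \<theta>) \<and>
    (\<forall>\<theta>' U' V\<^sub>p' V\<^sub>q'. is_factorization p q Q U' V\<^sub>p' V\<^sub>q' \<theta>' \<longrightarrow>
       eq_up_to_order_and_signs q \<theta> \<theta>')"
proof -
  obtain \<theta> U V\<^sub>p V\<^sub>q where fac: "is_factorization p q Q U V\<^sub>p V\<^sub>q \<theta>"
    using ex_factorization assms by blast
  have "eq_up_to_order_and_signs q \<theta> \<theta>'" if fac': "is_factorization p q Q U' V\<^sub>p' V\<^sub>q' \<theta>'"
    for \<theta>' U' V\<^sub>p' V\<^sub>q'
  proof -
    have "U \<in> orthogonal_group (p + q)" "U' \<in> orthogonal_group (p + q)"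
      using fac fac' by (auto simp: is_factorization_def)
    \<comment> \<open>Both factorizations diagonalize the same matrix, the real part of Q J
      Q^T.\<close>
    then have "mset (map (real_spectrum p q \<theta>) [0..<p + q]) = mset (map (real_spectrum p q \<theta>') [0..<p + q])"
      using factorization_Re_conj_sgn[OF assms(2) fac] factorization_Re_conj_sgn[OF assms(2) fac']
      by (intro orthogonal_conj_mat_diag_mset[of U _ U']) simp_all
    then show ?thesis by (rule real_spectrum_eq_up_to_order_and_signs[OF assms(2)])
  qed
  with fac show ?thesis by blast
qed

end
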